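(* Let $\Sigma$ be the normal fan of a simple convex polytope $P\subset\mathbb{R}^d$ of dimension $d$ with $n$ facets, and let $U\in\mathbb{R}^{n\times d}$ be its ray matrix. Let $\Delta\subseteq P$ be a face of $P$ which is a simplex of dimension $d-k>0$. Suppose that there exists a point $z_0\in{\rm Def}(\Sigma)$ such that $W_\Delta(z_0)=0$ and $P_{z_0}$ has dimension $d$. If $P_{z_0}$ has $n$ facets, then the adjoint polynomial ${\rm adj}_{P_{z_0}}(y)$ vanishes at any point $y$ satisfying $U_{\sigma_\Delta}\,y+(z_0)_{\sigma_\Delta}=0$. In particular, it vanishes at the vertex $v_\Delta(z_0)\in P_{z_0}$.
   Context: $\Sigma$ is the inner normal fan of $P$; it is simplicial and its rays $\Sigma(1)$ are identified with the facets of $P$. The ray matrix $U$ has rows $u_\rho$, $\rho\in\Sigma(1)$, with $u_\rho$ a nonzero generator of $\rho$. For $x\in\mathbb{R}^n$, $P_x=\{y\in\mathbb{R}^d:Uy+x\ge0\}$. The deformation cone ${\rm Def}(\Sigma)\subset\mathbb{R}^n$ is the set of $x$ such that the function $\phi:\mathbb{R}^d\to\mathbb{R}$ which is linear on each cone of $\Sigma$ with $\phi(u_\rho)=x_\rho$ is convex; equivalently, the set of $x$ for which the normal fan of $P_x$ is refined by $\Sigma$. For a face $\Delta\subseteq P$, $\sigma_\Delta\in\Sigma$ is its normal cone, generated by the rays of the facets containing $\Delta$. If $\Delta$ is a simplex of dimension $d-k>0$, ${\rm nb}(\Delta)$ is the set of the $d-k+1$ facets of $P$ which intersect $\Delta$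 in one of its facets, and (up to sign) $$W_\Delta(x)=\det\begin{pmatrix} U_{{\rm nb}(\Delta)} & x_{{\rm nb}(\Delta)} \\ U_{\sigma_\Delta} & x_{\sigma_\Delta} \end{pmatrix},$$ where $U_{{\rm nb}(\Delta)},U_{\sigma_\Delta}$ are the submatrices of $U$ with rows indexed by ${\rm nb}(\Delta)$ and by the rays of $\sigma_\Delta$, and $x_{{\rm nb}(\Delta)},x_{\sigma_\Delta}$ are the corresponding subvectors of $x$ (likewise $(z_0)_{\sigma_\Delta}$). If $W_\Delta(x)=0$, $v_\Delta(x)\in\mathbb{R}^d$ is the unique point with $$\begin{pmatrix} U_{{\rm nb}(\Delta)} & x_{{\rm nb}(\Delta)} \\ U_{\sigma_\Delta} & x_{\sigma_\Delta} \end{pmatrix}\begin{pmatrix} v_\Delta(x) \\ 1 \end{pmatrix}=0;$$ if moreover $x\in{\rm Def}(\Sigma)$, then $v_\Delta(x)$ is a vertex of $P_x$. Adjoint polynomial: for $z\in\mathbb{R}^n$ such that $P_z$ is $d$-dimensional, ${\rm adj}_{P_z}(y)$ is the polynomial in $y_1,\dots,y_d$ determined by $${\rm Vol}\big((P_z-y)^\circ\big)=\frac{{\rm adj}_{P_z}(y)}{\prod_\rho(u_\rho\cdot y+z_\rho)}\quad\text{for all }y\in{\rm int}(P_z),$$ the product being over those $\rho\in\Sigma(1)$ that define facets of $P_z$. Here $P_z-y$ is the translate, $K^\circ=\{u\in(\mathbb{R}^d)^\vee:u\cdot y'\ge-1\ \text{for all }y'\in K\}$, and ${\rm Vol}$ is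 $d!$ times Lebesgue measure. *)

theory Defs
  imports "HOL-Analysis.Analysis"
begin

text \<open>
  The ambient space is \<open>real ^ 'd\<close>, identified with its dual by the inner product.  A type \<open>'n\<close> with
  \<open>n\<close> elements labels the facets of \<open>P\<close>, equivalently the rays of its normal fan; the labelling
  \<open>F :: 'n \<Rightarrow> _\<close> is explicit.  Row \<open>i\<close> of \<open>U :: real ^ 'd ^ 'n\<close> is the vector \<open>U $ i\<close>.
\<close>

definition simple_polytope :: "'a::euclidean_space set \<Rightarrow> bool" where
  "simple_polytope P \<longleftrightarrow> polytope P \<and>
     (\<forall>v. v extreme_point_of P \<longrightarrow> int (card {G. G facet_of P \<and> v \<in> G}) = aff_dim P)"

text \<open>Inner normals: a functional lies in the cone of \<open>G\<close> iff its minimum over \<open>P\<close> is attained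
  on all of \<open>G\<close>.\<close>

definition normal_cone :: "'a::euclidean_space set \<Rightarrow> 'a set \<Rightarrow> 'a set" where
  "normal_cone P G = {u. \<forall>x\<in>G. \<forall>y\<in>P. u \<bullet> x \<le> u \<bullet> y}"

definition normal_fan :: "'a::euclidean_space set \<Rightarrow> 'a set set" where
  "normal_fan P = normal_cone P ` {G. G face_of P \<and> G \<noteq> {}}"

definition ray_matrix ::
  "(real ^ 'd) set \<Rightarrow> ('n \<Rightarrow> (real ^ 'd) set) \<Rightarrow> real ^ 'd ^ 'n \<Rightarrow> bool" where
  "ray_matrix P F U \<longleftrightarrow> bij_betw F UNIV {G. G facet_of P} \<and>
     (\<forall>i. U $ i \<noteq> 0 \<and> normal_cone P (F i) = cone hull {U $ i})"

definition deformed :: "real ^ 'd ^ 'n \<Rightarrow> real ^ 'n \<Rightarrow> (real ^ 'd) set" where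
  "deformed U x = {y. \<forall>i. (U *v y + x) $ i \<ge> 0}"

definition deformation_cone ::
  "(real ^ 'd) set set \<Rightarrow> real ^ 'd ^ 'n \<Rightarrow> (real ^ 'n) set" where
  "deformation_cone \<Sigma> U = {x. \<exists>\<phi> :: real ^ 'd \<Rightarrow> real.
     (\<forall>\<sigma>\<in>\<Sigma>. \<exists>g. linear g \<and> (\<forall>u\<in>\<sigma>. \<phi> u = g u)) \<and>
     (\<forall>i. \<phi> (U $ i) = x $ i) \<and> convex_on UNIV \<phi>}"

text \<open>The labels of the rays that generate the normal cone of the face \<open>D\<close>.\<close>

definition cone_rays :: "('n \<Rightarrow> 'a set) \<Rightarrow> 'a set \<Rightarrow> 'n set" where
  "cone_rays F D = {i. D \<subseteq> F i}"

definition nb :: "('n \<Rightarrow> 'a::euclidean_space set) \<Rightarrow> 'a set \<Rightarrow> 'n set" where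
  "nb F D = {i. (F i \<inter> D) facet_of D}"

text \<open>
  The square matrix with the rows of \<open>(U | x)\<close> labelled by \<open>nb F D \<union> cone_rays F D\<close>.  Its rows and
  columns are indexed by \<open>'d option\<close>, which has \<open>d + 1\<close> elements; the column \<open>None\<close> contains \<open>x\<close>.
  For a simplex face \<open>D\<close> of positive dimension of a simple polytope there are \<open>d + 1\<close> labels.
  The order in which they are enumerated affects the determinant \<open>W\<close> only up to sign.
\<close>

definition W_rows ::
  "('n \<Rightarrow> (real ^ 'd) set) \<Rightarrow> (real ^ 'd) set \<Rightarrow> 'd option \<Rightarrow> 'n" where
  "W_rows F D = (SOME e. bij_betw e UNIV (nb F D \<union> cone_rays F D))"

definition W_matrix ::
  "('n \<Rightarrow> (real ^ 'd) set) \<Rightarrow> real ^ 'd ^ 'n \<Rightarrow> (real ^ 'd) set \<Rightarrow> real ^ 'n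
     \<Rightarrow> real ^ ('d option) ^ ('d option)" where
  "W_matrix F U D x =
     (\<chi> r c. case c of Some j \<Rightarrow> U $ W_rows F D r $ j | None \<Rightarrow> x $ W_rows F D r)"

definition W ::
  "('n \<Rightarrow> (real ^ 'd) set) \<Rightarrow> real ^ 'd ^ 'n \<Rightarrow> (real ^ 'd) set \<Rightarrow> real ^ 'n \<Rightarrow> real" where
  "W F U D x = det (W_matrix F U D x)"

definition v_pt ::
  "('n \<Rightarrow> (real ^ 'd) set) \<Rightarrow> real ^ 'd ^ 'n \<Rightarrow> (real ^ 'd) set \<Rightarrow> real ^ 'n \<Rightarrow> real ^ 'd" where
  "v_pt F U D x =
     (THE v. W_matrix F U D x *v (\<chi> c. case c of Some j \<Rightarrow> v $ j | None \<Rightarrow> 1) = 0)"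

definition dual_body :: "'a::euclidean_space set \<Rightarrow> 'a set" where
  "dual_body K = {u. \<forall>y\<in>K. u \<bullet> y \<ge> -1}"

definition normalized_vol :: "'a::euclidean_space set \<Rightarrow> real" where
  "normalized_vol K = fact DIM('a) * measure lebesgue K"

definition facet_rays :: "real ^ 'd ^ 'n \<Rightarrow> real ^ 'n \<Rightarrow> 'n set" where
  "facet_rays U z = {i. {y \<in> deformed U z. U $ i \<bullet> y + z $ i = 0} facet_of deformed U z}"

text \<open>Over the reals a polynomial is determined by its polynomial function.\<close>

definition adj :: "real ^ 'd ^ 'n \<Rightarrow> real ^ 'n \<Rightarrow> real ^ 'd \<Rightarrow> real" where
  "adj U z = (THE p. real_polynomial_function p \<and>
     (\<forall>y\<in>interior (deformed U z).
        normalized_vol (dual_body ((\<lambda>w. w - y) ` deformed U z)) =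
          p y / (\<Prod>i\<in>facet_rays U z. U $ i \<bullet> y + z $ i)))"

end

theory Submission
  imports Defs
begin

text \<open>
  For a point \<open>y\<close> of the interior, the dual of \<open>P\<^bsub>z\<^esub> - y\<close> is cut by the normal cones of the vertices of
  \<open>P\<close> into the simplices with vertices \<open>0\<close> and \<open>u\<^sub>i / l\<^sub>i(y)\<close>, where \<open>l\<^sub>i(y) = u\<^sub>i \<bullet> y + z\<^sub>i\<close>; this uses that
  \<open>z\<close> is in the deformation cone.  Hence the adjoint is the sum, over the vertices \<open>v\<close> of \<open>P\<close>, of
  \<open>D(v)\<close> times the product of the \<open>l\<^sub>i\<close> over the facets \<open>i\<close> that miss \<open>v\<close>, where \<open>D(v)\<close> is the
  normalized volume of the simplex spanned by \<open>0\<close> and the rays at \<open>v\<close>.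

  On the affine space where the \<open>l\<^sub>i\<close> of the rays of \<open>\<sigma>\<close> vanish, only the vertices of the simplex \<open>\<Delta>\<close>
  contribute.  Such a vertex \<open>c\<close> lies on all facets in \<open>nb \<union> \<sigma>\<close> except the opposite one.  Fix one
  \<open>c\<close>, with opposite facet \<open>j\<close>, and write \<open>u\<^sub>j = \<Sum>i. b\<^sub>i u\<^sub>i\<close> in the basis of rays at \<open>c\<close>.
  Exchanging \<open>i\<close> for \<open>j\<close> multiplies the volume by \<open>\<bar>b\<^sub>i\<bar> = - b\<^sub>i\<close>, so up to common factors the sum is
  \<open>l\<^sub>j(y) - (\<Sum>i. b\<^sub>i l\<^sub>i(y))\<close>.  This vanishes because \<open>W = 0\<close> yields a common zero of all the \<open>l\<^sub>i\<close>
  with \<open>i \<in> nb \<union> \<sigma>\<close>.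
\<close>

text \<open>On the line through \<open>y\<close> and a point of \<open>S\<close> the difference
  becomes a univariate polynomial with infinitely many roots, hence zero. This makes the adjoint
  unique.\<close>

lemma real_polynomial_function_eq_on_open:
  fixes p q :: "'a::real_normed_vector \<Rightarrow> real"
  assumes p: "real_polynomial_function p" and q: "real_polynomial_function q"
    and S: "open S" "S \<noteq> {}" and eq: "\<And>y. y \<in> S \<Longrightarrow> p y = q y"
  shows "p = q"
proof
  fix y
  obtain a where a: "a \<in> S" using S by blast
  define l where "l t = a + t *\<^sub>R (y - a)" for t :: real
  define f where "f t = p (l t) - q (l t)" for t
  have pl: "polynomial_function l"
    unfolding l_def
    by (intro polynomial_function_add polynomial_function_const polynomial_function_bounded_linear
         bounded_linear_intros)
  have "real_polynomial_function f"
    using real_polynomial_function_diff[OF real_polynomial_function_compose[OF pl p]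
        real_polynomial_function_compose[OF pl q]]
    unfolding f_def o_def .
  then obtain c n where f: "f = (\<lambda>x. \<Sum>i\<le>n. c i * x ^ i)"
    using real_polynomial_function_iff_sum by blast
  have "open (l -` S)"
    using S(1) unfolding l_def by (intro open_vimage continuous_intros)
  moreover have "0 \<in> l -` S" using a by (simp add: l_def)
  ultimately have "infinite (l -` S)"
    using finite_imp_not_open by blast
  moreover have "l -` S \<subseteq> {t. f t = 0}" using eq by (auto simp: f_def)
  ultimately have inf: "infinite {t. f t = 0}" using finite_subset by blast
  have "c i = 0" if "i \<le> n" for i
    using polyfun_rootbound_finite[of n c] that inf by (auto simp: f)
  then have "f 1 = 0" by (simp add: f)
  then show "p y = q y" by (simp add: f_def l_def)
qed

subsection \<open>Volumes of simplices with a vertex at the origin\<close>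

text \<open>
  A well-ordered copy of the index type: the library proves the determinant formula for the measure
  of a linear image of \<open>real ^ 'n\<close> only for well-ordered \<open>'n\<close>.
\<close>

typedef ('a::finite) index_copy = "{..<CARD('a)}" by (rule exI[of _ 0]) simp

instantiation index_copy :: (finite) wellorder
begin
definition "i \<le> j \<longleftrightarrow> Rep_index_copy i \<le> Rep_index_copy j"
definition "i < j \<longleftrightarrow> Rep_index_copy i < Rep_index_copy j"
instance
proof
  fix Q :: "'a index_copy \<Rightarrow> bool" and a
  assume step: "\<And>x. (\<And>y. y < x \<Longrightarrow> Q y) \<Longrightarrow> Q x"
  show "Q a"
    by (induction a rule: measure_induct_rule[of Rep_index_copy])
       (use step less_index_copy_def in blast)
qed (auto simp: less_eq_index_copy_def less_index_copy_def Rep_index_copy_inject)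
end

instance index_copy :: (finite) finite
  by intro_classes (metis Abs_index_copy_cases finite_imageI finite_lessThan finite_subset imageI subsetI)

lemma card_index_copy: "CARD('a::finite index_copy) = CARD('a)"
  using type_definition.card[OF type_definition_index_copy] by simp

definition relabel :: "'a::finite index_copy \<Rightarrow> 'a" where
  "relabel = (SOME f. bij f)"

lemma bij_relabel: "bij relabel"
proof -
  have "\<exists>f :: 'a index_copy \<Rightarrow> 'a. bij f"
    by (metis card_index_copy finite_class.finite_UNIV finite_same_card_bij)
  then show ?thesis unfolding relabel_def by (rule someI_ex)
qed

definition relabel_vec :: "real ^ 'a::finite \<Rightarrow> real ^ 'a index_copy" where
  "relabel_vec x = (\<chi> i. x $ relabel i)"

lemma linear_relabel_vec: "linear relabel_vec"
  by (intro linearI) (auto simp: relabel_vec_def vec_eq_iff)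

lemma inj_relabel_vec: "inj relabel_vec"
proof (rule injI)
  fix x y :: "real ^ 'a"
  assume "relabel_vec x = relabel_vec y"
  then have "x $ relabel i = y $ relabel i" for i by (auto simp: relabel_vec_def vec_eq_iff)
  then show "x = y" by (metis bij_relabel bij_pointE vec_eq_iff)
qed

text \<open>Relabelling only permutes the sides of a box, so boxes keep their volume, and the
  volumes of boxes determine the measure.\<close>

lemma lborel_relabel_vec:
  "distr lborel borel relabel_vec = (lborel :: (real ^ 'a::finite index_copy) measure)"
proof (rule lborel_eqI[symmetric])
  have "continuous_on UNIV (relabel_vec :: real ^ 'a \<Rightarrow> _)"
    by (rule linear_continuous_on[OF linear_relabel_vec[unfolded linear_conv_bounded_linear]])
  then have m: "relabel_vec \<in> borel_measurable (lborel :: (real ^ 'a) measure)"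
    using borel_measurable_continuous_onI measurable_lborel2 by blast
  fix l u :: "real ^ 'a index_copy"
  assume le: "\<And>b. b \<in> Basis \<Longrightarrow> l \<bullet> b \<le> u \<bullet> b"
  have le': "l $ i \<le> u $ i" for i
    using le[of "axis i 1"] by (simp add: inner_axis axis_in_Basis_iff)
  let ?g = "\<lambda>z :: real ^ 'a index_copy. (\<chi> j. z $ inv relabel j) :: real ^ 'a"
  have bi: "bij (inv relabel :: 'a \<Rightarrow> _)" by (simp add: bij_relabel bij_imp_bij_inv)
  have pre: "relabel_vec -` box l u = box (?g l) (?g u)"
  proof (intro set_eqI)
    fix x :: "real ^ 'a"
    show "x \<in> relabel_vec -` box l u \<longleftrightarrow> x \<in> box (?g l) (?g u)"
      unfolding vimage_eq mem_box_cart relabel_vec_def vec_lambda_beta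
      by (metis bij_relabel bij_inv_eq_iff)
  qed
  have cart: "(\<Prod>b\<in>Basis. (v - w) \<bullet> b) = (\<Prod>i\<in>UNIV. v $ i - w $ i)" for v w :: "real ^ 'k::finite"
  proof -
    have B: "Basis = range (\<lambda>i. axis i (1::real) :: real ^ 'k)" by (auto simp: Basis_vec_def)
    show ?thesis unfolding B
      by (subst prod.reindex) (auto simp: inj_def axis_eq_axis inner_axis)
  qed
  have "emeasure (distr lborel borel relabel_vec) (box l u) = emeasure lborel (box (?g l) (?g u))"
    using m by (subst emeasure_distr) (auto simp: pre)
  also have "\<dots> = (\<Prod>b\<in>Basis. (?g u - ?g l) \<bullet> b)"
  proof (rule emeasure_lborel_box)
    fix b :: "real ^ 'a" assume "b \<in> Basis"
    then show "?g l \<bullet> b \<le> ?g u \<bullet> b" using le' by (auto simp: Basis_vec_def inner_axis)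
  qed
  also have "(\<Prod>b\<in>Basis. (?g u - ?g l) \<bullet> b) = (\<Prod>b\<in>Basis. (u - l) \<bullet> b)"
    unfolding cart by (simp add: prod.reindex_bij_betw[OF bi, of "\<lambda>i. u $ i - l $ i"])
  finally show "emeasure (distr lborel borel relabel_vec) (box l u) = (\<Prod>b\<in>Basis. (u - l) \<bullet> b)" .
qed simp

lemma measure_relabel_vec:
  fixes K :: "(real ^ 'a::finite) set"
  assumes "compact K"
  shows "measure lebesgue (relabel_vec ` K) = measure lebesgue K"
proof -
  have c: "continuous_on UNIV (relabel_vec :: real ^ 'a \<Rightarrow> _)"
    using linear_continuous_on[OF linear_relabel_vec[unfolded linear_conv_bounded_linear]] .
  then have K': "compact (relabel_vec ` K)"
    using assms compact_continuous_image continuous_on_subset by blast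
  have "measure lborel (relabel_vec ` K) = measure (distr lborel borel relabel_vec) (relabel_vec ` K)"
    by (simp add: lborel_relabel_vec)
  also have "\<dots> = measure lborel (relabel_vec -` relabel_vec ` K)"
    using c K' by (subst measure_distr) (auto intro: borel_measurable_continuous_onI dest: compact_imp_closed)
  also have "relabel_vec -` relabel_vec ` K = K" using inj_relabel_vec by (rule inj_vimage_image_eq)
  finally show ?thesis
    using K' assms by (simp add: compact_imp_closed)
qed

section \<open>Measure of a simplex spanned by the origin and scaled rays\<close>

text \<open>For finite \<open>I\<close> and positive \<open>s\<close> this is the convex hull of 0
  and the points \<open>u i\<close> divided by \<open>s i\<close>. Conic coefficients show it
  directly as a piece of the cone over the \<open>u i\<close>.\<close>

definition corner_simplex :: "('i \<Rightarrow> 'a::real_vector) \<Rightarrow> ('i \<Rightarrow> real) \<Rightarrow> 'i set \<Rightarrow> 'a set" where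
  "corner_simplex u s I =
     {\<Sum>i\<in>I. c i *\<^sub>R u i | c. (\<forall>i\<in>I. 0 \<le> c i) \<and> (\<Sum>i\<in>I. c i * s i) \<le> 1}"

lemma std_simplex_cart:
  "convex hull (insert 0 Basis) = {x :: real ^ 'k::finite. (\<forall>i. 0 \<le> x $ i) \<and> (\<Sum>i\<in>UNIV. x $ i) \<le> 1}"
proof -
  have B: "Basis = range (\<lambda>i. axis i (1::real) :: real ^ 'k)" by (auto simp: Basis_vec_def)
  have s: "sum ((\<bullet>) x) Basis = (\<Sum>i\<in>UNIV. x $ i)" for x :: "real ^ 'k"
    unfolding B by (subst sum.reindex) (auto simp: inj_def axis_eq_axis inner_axis)
  show ?thesis
    unfolding std_simplex s by (auto simp: Basis_vec_def inner_axis)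
qed

text \<open>Among bijective enumerations of a fixed set only the sign depends on \<open>e\<close>;
  volumes use the absolute value.\<close>

definition corner_det :: "('i \<Rightarrow> real ^ 'a::finite) \<Rightarrow> ('a index_copy \<Rightarrow> 'i) \<Rightarrow> real" where
  "corner_det u e = det (\<chi> r. relabel_vec (u (e r)))"

text \<open>The simplex is the image of the standard simplex, whose volume is the inverse of the
  factorial, under the linear map that sends the unit vectors to the \<open>u i\<close> divided by
  \<open>s i\<close>.\<close>

lemma corner_simplex_measure:
  fixes u :: "'i \<Rightarrow> real ^ 'a::finite"
  assumes e: "bij_betw e (UNIV :: 'a index_copy set) I" and s: "\<And>i. i \<in> I \<Longrightarrow> 0 < s i"
  shows "corner_simplex u s I \<in> lmeasurable"
    and "fact CARD('a) * measure lebesgue (corner_simplex u s I) = \<bar>corner_det u e\<bar> / prod s I"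
proof -
  let ?std = "convex hull (insert 0 Basis) :: (real ^ 'a index_copy) set"
  define f where "f x = (\<Sum>r\<in>UNIV. (x $ r / s (e r)) *\<^sub>R u (e r))" for x :: "real ^ 'a index_copy"
  have lin: "linear f"
    unfolding f_def
    by (intro linearI) (auto simp: sum.distrib scaleR_sum_right add_divide_distrib algebra_simps)
  have er: "e r \<in> I" for r using e by (auto simp: bij_betw_def)
  have img: "corner_simplex u s I = f ` ?std"
  proof (intro subset_antisym subsetI)
    fix y assume "y \<in> corner_simplex u s I"
    then obtain c where c: "y = (\<Sum>i\<in>I. c i *\<^sub>R u i)" "\<forall>i\<in>I. 0 \<le> c i" "(\<Sum>i\<in>I. c i * s i) \<le> 1"
      by (auto simp: corner_simplex_def)
    define x :: "real ^ 'a index_copy" where "x = (\<chi> r. c (e r) * s (e r))"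
    have sr: "s (e r) \<noteq> 0" for r using s[OF er[of r]] by simp
    have "f x = y"
      using sum.reindex_bij_betw[OF e, of "\<lambda>i. c i *\<^sub>R u i"] sr
      by (simp add: f_def x_def c(1))
    moreover have "x \<in> ?std"
      unfolding std_simplex_cart
      using c er s sum.reindex_bij_betw[OF e, of "\<lambda>i. c i * s i"]
      by (auto simp: x_def less_imp_le)
    ultimately show "y \<in> f ` ?std" by blast
  next
    fix y assume "y \<in> f ` ?std"
    then obtain x where x: "y = f x" "\<forall>r. 0 \<le> x $ r" "(\<Sum>r\<in>UNIV. x $ r) \<le> 1"
      unfolding std_simplex_cart by auto
    define c where "c i = x $ (the_inv e i) / s i" for i
    have inj: "inj e" using e by (auto simp: bij_betw_def)
    have ce: "c (e r) = x $ r / s (e r)" for r by (simp add: c_def the_inv_f_f[OF inj])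
    have "y = (\<Sum>i\<in>I. c i *\<^sub>R u i)"
      using sum.reindex_bij_betw[OF e, of "\<lambda>i. c i *\<^sub>R u i"] by (simp add: x(1) f_def ce)
    moreover have "(\<Sum>i\<in>I. c i * s i) \<le> 1"
    proof -
      have "c (e r) * s (e r) = x $ r" for r using s[OF er[of r]] by (simp add: ce)
      then show ?thesis using sum.reindex_bij_betw[OF e, of "\<lambda>i. c i * s i"] x(3) by simp
    qed
    moreover have "0 \<le> c i" if "i \<in> I" for i
      using x(2) s[OF that] by (simp add: c_def)
    ultimately show "y \<in> corner_simplex u s I" unfolding corner_simplex_def by blast
  qed
  have std: "compact ?std" by (intro finite_imp_compact_convex_hull) auto
  then have cpt: "compact (corner_simplex u s I)"
    unfolding img using lin compact_continuous_image linear_continuous_on linear_linear by blast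
  then show "corner_simplex u s I \<in> lmeasurable" by (rule lmeasurable_compact)
  \<comment> \<open>Composition with the measure-preserving \<open>relabel_vec\<close> gives a map
    of one space into itself, which has a determinant.\<close>
  let ?g = "\<lambda>x. relabel_vec (f x)"
  have lg: "linear ?g" using linear_compose[OF lin linear_relabel_vec] by (simp add: o_def)
  have "f (axis r 1) = (1 / s (e r)) *\<^sub>R u (e r)" for r
  proof -
    have "f (axis r 1) = (\<Sum>q\<in>UNIV. if q = r then (1 / s (e q)) *\<^sub>R u (e q) else 0)"
      unfolding f_def by (intro sum.cong) (auto simp: axis_def)
    then show ?thesis by simp
  qed
  then have "?g (axis r 1) = (1 / s (e r)) *\<^sub>R relabel_vec (u (e r))" for r
    by (simp only: linear_cmul[OF linear_relabel_vec])
  then have "transpose (matrix ?g) = (\<chi> r. (1 / s (e r)) *s relabel_vec (u (e r)))"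
    by (simp add: matrix_def transpose_def vec_eq_iff)
  then have "det (matrix ?g) = (\<Prod>r\<in>UNIV. 1 / s (e r)) * corner_det u e"
    unfolding corner_det_def det_rows_mul[symmetric] using det_transpose[of "matrix ?g"] by simp
  also have "(\<Prod>r\<in>UNIV. 1 / s (e r)) = 1 / prod s I"
    using prod.reindex_bij_betw[OF e, of s] by (simp add: prod_dividef)
  finally have dg: "\<bar>det (matrix ?g)\<bar> = \<bar>corner_det u e\<bar> / prod s I"
    using prod_pos[of I s] s by (simp add: abs_mult)
  have "measure lebesgue (corner_simplex u s I) = measure lebesgue (?g ` ?std)"
    using measure_relabel_vec[OF cpt] by (simp add: img image_image)
  also have "\<dots> = \<bar>det (matrix ?g)\<bar> * measure lebesgue ?std"
    by (rule measure_linear_image[OF lg lmeasurable_compact[OF std]])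
  also have "measure lebesgue ?std = 1 / fact CARD('a)"
    using content_std_simplex[where 'a="real ^ 'a index_copy"] std
    by (simp add: card_index_copy compact_imp_closed)
  finally show "fact CARD('a) * measure lebesgue (corner_simplex u s I) = \<bar>corner_det u e\<bar> / prod s I"
    by (simp add: dg)
qed

text \<open>This is Cramer's rule: modulo the span of the other rows, the new row is
  \<open>b i\<close> times the old one.\<close>

lemma corner_det_replace:
  fixes u :: "'i \<Rightarrow> real ^ 'a::finite"
  assumes e: "bij_betw e (UNIV :: 'a index_copy set) I" and i: "e r = i"
    and uj: "u j = (\<Sum>l\<in>I. b l *\<^sub>R u l)"
  shows "corner_det u (e(r := j)) = b i * corner_det u e"
proof -
  define A :: "real ^ 'a index_copy ^ 'a index_copy" where "A = (\<chi> q. relabel_vec (u (e q)))"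
  define B where "B = (\<chi> q. if q = r then b i *s row q A else row q A)"
  have row: "row q A = relabel_vec (u (e q))" for q by (simp add: A_def row_def)
  have rowB: "row q B = (if q = r then b i *s row q A else row q A)" for q
    by (simp add: B_def row_def vec_eq_iff)
  define x where "x = (\<Sum>q\<in>UNIV - {r}. b (e q) *\<^sub>R relabel_vec (u (e q)))"
  have "relabel_vec (u j) = (\<Sum>l\<in>I. b l *\<^sub>R relabel_vec (u l))"
    by (simp add: uj linear_sum[OF linear_relabel_vec] linear_cmul[OF linear_relabel_vec])
  also have "\<dots> = (\<Sum>q\<in>UNIV. b (e q) *\<^sub>R relabel_vec (u (e q)))"
    using sum.reindex_bij_betw[OF e, of "\<lambda>l. b l *\<^sub>R relabel_vec (u l)"] by simp
  also have "\<dots> = b i *\<^sub>R relabel_vec (u i) + x"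
    unfolding x_def by (subst sum.remove[of _ r]) (auto simp: i)
  finally have uj': "relabel_vec (u j) = row r B + x"
    by (simp add: rowB row i scalar_mult_eq_scaleR)
  have "x \<in> vec.span {row q B | q. q \<noteq> r}"
    unfolding x_def scalar_mult_eq_scaleR[symmetric]
    by (intro vec.span_sum vec.span_scale vec.span_base) (auto simp: rowB row)
  then have "det (\<chi> q. if q = r then row r B + x else row q B) = det B"
    by (rule det_row_span)
  moreover have "(\<chi> q. if q = r then row r B + x else row q B) = (\<chi> q. relabel_vec (u ((e(r := j)) q)))"
    unfolding vec_eq_iff[of "vec_lambda _"] by (simp add: uj'[symmetric]) (simp add: rowB row)
  moreover have "(\<chi> q. if q = r then row q A else row q A) = A" by (simp add: row) (simp add: A_def)
  then have "det B = b i * det A"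
    using det_row_mul[of r "b i" "\<lambda>q. row q A" "\<lambda>q. row q A"] by (simp add: B_def cong: if_cong)
  ultimately show ?thesis by (simp add: corner_det_def A_def)
qed

subsection \<open>Vertices and normal cones of a simple polytope\<close>

text \<open>The vectors other than \<open>u j\<close> are too few to span, so some nonzero
  \<open>a\<close> is orthogonal to all of them. By \<open>sep\<close> it has
  \<open>u j \<bullet> a \<noteq> 0\<close>, and scaling it gives \<open>w j\<close>.\<close>

lemma dual_basis:
  fixes u :: "'i \<Rightarrow> 'a::euclidean_space"
  assumes "finite I" and card: "card I = DIM('a)"
    and sep: "\<And>x. (\<And>i. i \<in> I \<Longrightarrow> u i \<bullet> x = 0) \<Longrightarrow> x = 0"
  obtains w where "\<And>i j. i \<in> I \<Longrightarrow> j \<in> I \<Longrightarrow> u i \<bullet> w j = (if i = j then 1 else 0)"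
    and "\<And>x. x = (\<Sum>i\<in>I. (x \<bullet> w i) *\<^sub>R u i)"
    and "\<And>x. x = (\<Sum>i\<in>I. (u i \<bullet> x) *\<^sub>R w i)"
proof -
  have "\<exists>a. \<forall>i\<in>I. u i \<bullet> a = (if i = j then 1 else 0)" if j: "j \<in> I" for j
  proof -
    have "card (u ` (I - {j})) < DIM('a)"
      using card_image_le[of "I - {j}" u] assms(1) j card
      by (metis card_Diff1_less finite_Diff le_less_trans)
    then have "span (u ` (I - {j})) \<noteq> UNIV"
      by (metis assms(1) dim_UNIV dim_le_card dim_span finite_Diff finite_imageI leD span_superset)
    then obtain a where a: "a \<noteq> 0" "\<And>x. x \<in> span (u ` (I - {j})) \<Longrightarrow> a \<bullet> x = 0"
      using span_not_UNIV_orthogonal by blast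
    then have z: "u i \<bullet> a = 0" if "i \<in> I" "i \<noteq> j" for i
      using that a(2)[of "u i"] by (simp add: inner_commute[of a] span_base)
    then have "u j \<bullet> a \<noteq> 0" using sep[of a] a(1) j by metis
    then show ?thesis using z by (intro exI[of _ "a /\<^sub>R (u j \<bullet> a)"]) auto
  qed
  then obtain w where w: "\<And>i j. i \<in> I \<Longrightarrow> j \<in> I \<Longrightarrow> u i \<bullet> w j = (if i = j then 1 else 0)"
    by metis
  have 3: "x = (\<Sum>i\<in>I. (u i \<bullet> x) *\<^sub>R w i)" for x
  proof -
    have "u j \<bullet> (x - (\<Sum>i\<in>I. (u i \<bullet> x) *\<^sub>R w i)) = 0" if "j \<in> I" for j
    proof -
      have "u j \<bullet> (\<Sum>i\<in>I. (u i \<bullet> x) *\<^sub>R w i) = (\<Sum>i\<in>I. if i = j then u i \<bullet> x else 0)"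
        unfolding inner_sum_right by (intro sum.cong) (auto simp: w that)
      then show ?thesis using that assms(1) by (simp add: inner_diff_right)
    qed
    then show ?thesis using sep by fastforce
  qed
  have 2: "x = (\<Sum>i\<in>I. (x \<bullet> w i) *\<^sub>R u i)" for x
  proof -
    have "x \<bullet> y = (\<Sum>i\<in>I. (x \<bullet> w i) *\<^sub>R u i) \<bullet> y" for y
      by (subst 3[of y]) (simp add: inner_sum_left inner_sum_right mult.commute)
    then show ?thesis using vector_eq_rdot by blast
  qed
  show ?thesis using that[OF w 2 3] .
qed

text \<open>A facet has codimension one, which leaves no dimension for a face strictly between it
  and \<open>Q\<close>.\<close>

lemma facet_of_eq_face:
  assumes "convex Q" "G facet_of Q" "H face_of Q" "G \<subseteq> H" "H \<noteq> Q"
  shows "G = H"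
proof (rule ccontr)
  assume "G \<noteq> H"
  have "G face_of H"
    using assms face_of_subset facet_of_imp_face_of face_of_imp_subset by blast
  then have "aff_dim G < aff_dim H"
    using face_of_aff_dim_lt \<open>G \<noteq> H\<close> assms(3) face_of_imp_convex by blast
  moreover have "aff_dim H < aff_dim Q"
    using face_of_aff_dim_lt assms by blast
  ultimately show False using assms(2) by (simp add: facet_of_def)
qed

lemma full_dim_not_in_hyperplane:
  fixes Q :: "'a::euclidean_space set"
  assumes "aff_dim Q = int DIM('a)" "a \<noteq> 0"
  shows "\<not> Q \<subseteq> {x. a \<bullet> x = b}"
  using aff_dim_subset[of Q "{x. a \<bullet> x = b}"] assms by auto

section \<open>Facets, heights and vertices of \<open>P\<close>\<close>

locale simple_polytope_rays =
  fixes P :: "(real ^ 'd) set" and F :: "'n::finite \<Rightarrow> (real ^ 'd) set" and U :: "real ^ 'd ^ 'n"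
  assumes simple: "simple_polytope P" and full_dim: "aff_dim P = int CARD('d)"
    and rays: "ray_matrix P F U"
begin

lemma polytope: "polytope P" using simple by (simp add: simple_polytope_def)
lemma polyhedron: "polyhedron P" using polytope by (rule polytope_imp_polyhedron)
lemma convex_P: "convex P" using polytope by (rule polytope_imp_convex)

lemma ray_nonzero: "U $ i \<noteq> 0" using rays by (auto simp: ray_matrix_def)

lemma facet: "F i facet_of P"
  using rays by (auto simp: ray_matrix_def bij_betw_def)

lemma facetE: assumes "G facet_of P" obtains i where "G = F i"
  using rays assms unfolding ray_matrix_def bij_betw_def by (metis imageE mem_Collect_eq)

lemma inj_F: "inj F" using rays by (auto simp: ray_matrix_def bij_betw_def)

text \<open>The functional \<open>U $ i\<close> is minimal, hence constant, on \<open>F i\<close>,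
  so the chosen point does not matter. On \<open>P\<close> the height \<open>ht i\<close> is a
  scaled distance from the hyperplane of \<open>F i\<close>.\<close>

definition offset :: "'n \<Rightarrow> real" where "offset i = U $ i \<bullet> (SOME y. y \<in> F i)"
definition ht :: "'n \<Rightarrow> real ^ 'd \<Rightarrow> real" where "ht i y = U $ i \<bullet> y - offset i"

lemma ht_diff: "ht i x - ht i y = U $ i \<bullet> (x - y)"
  by (simp add: ht_def inner_diff_right)

lemma ht_facet: "y \<in> F i \<Longrightarrow> ht i y = 0"
  and ht_nonneg: "y \<in> P \<Longrightarrow> 0 \<le> ht i y"
proof -
  have "U $ i \<in> normal_cone P (F i)" using rays by (simp add: ray_matrix_def hull_inc)
  then have *: "U $ i \<bullet> x \<le> U $ i \<bullet> y" if "x \<in> F i" "y \<in> P" for x y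
    using that by (simp add: normal_cone_def)
  have "F i \<noteq> {}" "F i \<subseteq> P" using facet facet_of_imp_subset by (auto simp: facet_of_def)
  then have s: "(SOME y. y \<in> F i) \<in> F i" by (simp add: some_in_eq)
  show "ht i y = 0" if "y \<in> F i"
    using *[of y] *[OF s, of y] s \<open>F i \<subseteq> P\<close> that by (force simp: ht_def offset_def)
  show "0 \<le> ht i y" if "y \<in> P"
    using *[OF s that] by (simp add: ht_def offset_def)
qed

text \<open>The points of height zero form a face that contains \<open>F i\<close>; it is proper
  because \<open>P\<close> is full-dimensional, and a facet is a maximal proper face.\<close>

lemma facet_eq: "F i = {y \<in> P. ht i y = 0}"
proof -
  let ?H = "P \<inter> {y. U $ i \<bullet> y = offset i}"
  have "F i = ?H"
  proof (rule facet_of_eq_face[OF convex_P facet])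
    show "?H face_of P"
      using ht_nonneg by (intro face_of_Int_supporting_hyperplane_ge convex_P) (auto simp: ht_def)
    show "F i \<subseteq> ?H" using facet_of_imp_subset[OF facet] ht_facet by (auto simp: ht_def)
    show "?H \<noteq> P"
      using full_dim_not_in_hyperplane[of P "U $ i" "offset i"] full_dim ray_nonzero by auto
  qed
  then show ?thesis by (auto simp: ht_def)
qed

text \<open>In an irredundant description of \<open>P\<close> each half-space cuts out a facet,
  whose normal cone is a single ray. So each inequality is implied by some
  \<open>0 \<le> ht i y\<close>.\<close>

lemma P_eq: "P = {y. \<forall>i. 0 \<le> ht i y}"
proof
  show "P \<subseteq> {y. \<forall>i. 0 \<le> ht i y}" using ht_nonneg by blast
  obtain \<H> where fin: "finite \<H>" and P: "P = affine hull P \<inter> \<Inter>\<H>"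
    and hs: "\<forall>h\<in>\<H>. \<exists>a b. a \<noteq> 0 \<and> h = {x. a \<bullet> x \<le> b}"
    and min: "\<forall>\<H>'\<subset>\<H>. P \<subset> affine hull P \<inter> \<Inter>\<H>'"
    using polyhedron polyhedron_Int_affine_minimal[of P] by meson
  obtain a b where ab: "\<And>h. h \<in> \<H> \<Longrightarrow> a h \<noteq> 0 \<and> h = {x. a h \<bullet> x \<le> b h}"
    using hs by metis
  have un: "affine hull P = UNIV" using full_dim aff_dim_eq_full by (metis DIM_cart DIM_real mult.right_neutral)
  show "{y. \<forall>i. 0 \<le> ht i y} \<subseteq> P"
  proof
    fix y assume y: "y \<in> {y. \<forall>i. 0 \<le> ht i y}"
    have "y \<in> h" if h: "h \<in> \<H>" for h
    proof -
      have le: "a h \<bullet> x \<le> b h" if "x \<in> P" for x using P ab[OF h] h that by blast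
      have "P \<inter> {x. a h \<bullet> x = b h} facet_of P"
        using facet_of_polyhedron_explicit[OF fin P ab] min h by blast
      then obtain i where i: "P \<inter> {x. a h \<bullet> x = b h} = F i" by (metis facetE)
      \<comment> \<open>The half-spaces are written with \<open>\<le>\<close>, so the inner normal
        is \<open>- a h\<close>.\<close>
      have "- a h \<in> normal_cone P (F i)"
        using le by (auto simp: normal_cone_def i[symmetric])
      then have "- a h \<in> cone hull {U $ i}" using rays by (simp add: ray_matrix_def)
      then obtain c where c: "0 \<le> c" "- a h = c *\<^sub>R U $ i" by (auto simp: cone_hull_expl)
      obtain x where x: "x \<in> F i" using facet by (auto simp: facet_of_def)
      have "a h \<bullet> x = b h" using x i by blast
      moreover have "a h \<bullet> v = - (c * (U $ i \<bullet> v))" for v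
        using c(2) by (metis inner_minus_left inner_scaleR_left minus_minus)
      moreover have "U $ i \<bullet> x \<le> U $ i \<bullet> y"
        using ht_facet[OF x] y by (auto simp: ht_def)
      ultimately have "a h \<bullet> y \<le> b h" using c(1) by (metis mult_left_mono neg_le_iff_le)
      then show ?thesis using ab[OF h] by blast
    qed
    then show "y \<in> P" using P un by blast
  qed
qed

definition tight :: "real ^ 'd \<Rightarrow> 'n set" where "tight v = {i. v \<in> F i}"

lemma tight_iff: "v \<in> P \<Longrightarrow> i \<in> tight v \<longleftrightarrow> ht i v = 0"
  using facet_eq by (auto simp: tight_def)

definition vertices :: "(real ^ 'd) set" where "vertices = {v. v extreme_point_of P}"

lemma finite_vertices: "finite vertices"
  unfolding vertices_def using polyhedron by (rule finite_polyhedron_extreme_points)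

lemma vertex_in: "v \<in> vertices \<Longrightarrow> v \<in> P"
  by (simp add: vertices_def extreme_point_of_def)

lemma card_tight: assumes "v \<in> vertices" shows "card (tight v) = CARD('d)"
proof -
  have "{G. G facet_of P \<and> v \<in> G} = F ` tight v"
    using facet facetE by (auto simp: tight_def) (metis image_iff mem_Collect_eq)
  then have "card {G. G facet_of P \<and> v \<in> G} = card (tight v)"
    using card_image inj_F inj_on_subset by (metis top_greatest)
  then show ?thesis using assms simple full_dim by (auto simp: simple_polytope_def vertices_def)
qed

text \<open>Heights that vanish at \<open>v\<close> do not decrease along \<open>w\<close>; the
  finitely many others stay positive for small steps by continuity.\<close>

lemma feasible_direction:
  assumes v: "v \<in> P" and w: "\<And>i. i \<in> tight v \<Longrightarrow> 0 \<le> U $ i \<bullet> w"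
  obtains e where "0 < e" "v + e *\<^sub>R w \<in> P"
proof -
  have "\<forall>\<^sub>F e in at_right (0::real). 0 \<le> ht i (v + e *\<^sub>R w)" for i
  proof (cases "i \<in> tight v")
    case True
    then have "0 \<le> ht i (v + e *\<^sub>R w)" if "0 < e" for e
      using that w[OF True] tight_iff[OF v, of i] by (simp add: ht_def inner_add_right)
    then show ?thesis by (auto intro: eventually_mono[OF eventually_at_right_less])
  next
    case False
    then have pos: "0 < ht i v" using ht_nonneg[OF v, of i] tight_iff[OF v, of i] by auto
    have "((\<lambda>e. ht i (v + e *\<^sub>R w)) \<longlongrightarrow> ht i (v + 0 *\<^sub>R w)) (at_right 0)"
      unfolding ht_def by (intro tendsto_intros)
    then have "\<forall>\<^sub>F e in at_right 0. 0 < ht i (v + e *\<^sub>R w)"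
      using pos order_tendstoD(1) by force
    then show ?thesis by (rule eventually_mono) simp
  qed
  then have "\<forall>\<^sub>F e in at_right (0::real). \<forall>i. 0 \<le> ht i (v + e *\<^sub>R w)"
    by (rule eventually_all_finite)
  then have "\<forall>\<^sub>F e in at_right (0::real). 0 < e \<and> v + e *\<^sub>R w \<in> P"
    using eventually_at_right_less[of "0::real"] by eventually_elim (use P_eq in auto)
  then show ?thesis using that eventually_happens' trivial_limit_at_right_real by blast
qed

text \<open>Otherwise \<open>v\<close> could move slightly along both \<open>x\<close> and
  \<open>- x\<close> within \<open>P\<close> and would not be extreme. Hence the rays at
  \<open>v\<close> span the space.\<close>

lemma vertex_separates:
  assumes v: "v \<in> vertices" and x: "\<And>i. i \<in> tight v \<Longrightarrow> U $ i \<bullet> x = 0"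
  shows "x = 0"
proof (rule ccontr)
  assume "x \<noteq> 0"
  obtain e where e: "0 < e" "v + e *\<^sub>R x \<in> P"
    using feasible_direction[OF vertex_in[OF v], of x] x by auto
  obtain f where f: "0 < f" "v + f *\<^sub>R (- x) \<in> P"
    using feasible_direction[OF vertex_in[OF v], of "- x"] x by auto
  let ?a = "v + e *\<^sub>R x" and ?b = "v + f *\<^sub>R (- x)"
  have "?a - ?b = (e + f) *\<^sub>R x" by (simp add: algebra_simps)
  then have "?a \<noteq> ?b" using e f \<open>x \<noteq> 0\<close> by auto
  \<comment> \<open>This \<open>t\<close> weights the two ends so that the displacements by
    \<open>e\<close> and \<open>f\<close> cancel.\<close>
  moreover have "v = (1 - t) *\<^sub>R ?a + t *\<^sub>R ?b" if "t = e / (e + f)" for t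
  proof -
    have 0: "(1 - t) * e - t * f = 0" using e f that by (simp add: field_simps)
    have "(1 - t) *\<^sub>R ?a + t *\<^sub>R ?b = v + ((1 - t) * e - t * f) *\<^sub>R x"
      by (simp add: algebra_simps)
    then show ?thesis by (simp add: 0)
  qed
  moreover have "0 < e / (e + f)" "e / (e + f) < 1" using e f by auto
  ultimately have "v \<in> open_segment ?a ?b" unfolding in_segment by blast
  then show False using v e f by (auto simp: vertices_def extreme_point_of_def)
qed

section \<open>Dual bases and normal cones at the vertices\<close>

text \<open>For a vertex \<open>v\<close>, the vector \<open>w i\<close> is the direction of the
  edge that leaves the facet \<open>i\<close> and stays on the other facets through
  \<open>v\<close>.\<close>

definition dual_at :: "real ^ 'd \<Rightarrow> ('n \<Rightarrow> real ^ 'd) \<Rightarrow> bool" where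
  "dual_at v w \<longleftrightarrow>
     (\<forall>i\<in>tight v. \<forall>j\<in>tight v. U $ i \<bullet> w j = (if i = j then 1 else 0)) \<and>
     (\<forall>x. x = (\<Sum>i\<in>tight v. (x \<bullet> w i) *\<^sub>R U $ i)) \<and>
     (\<forall>x. x = (\<Sum>i\<in>tight v. (U $ i \<bullet> x) *\<^sub>R w i))"

lemma dual_at_inner:
  "dual_at v w \<Longrightarrow> i \<in> tight v \<Longrightarrow> j \<in> tight v \<Longrightarrow> U $ i \<bullet> w j = (if i = j then 1 else 0)"
  by (simp add: dual_at_def)

lemma dual_at_expand: "dual_at v w \<Longrightarrow> x = (\<Sum>i\<in>tight v. (x \<bullet> w i) *\<^sub>R U $ i)"
  and dual_at_expand': "dual_at v w \<Longrightarrow> x = (\<Sum>i\<in>tight v. (U $ i \<bullet> x) *\<^sub>R w i)"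
  unfolding dual_at_def by blast+

lemma ex_dual_at:
  assumes v: "v \<in> vertices"
  obtains w where "dual_at v w"
proof (rule dual_basis[of "tight v" "($) U"])
  show "finite (tight v)" by simp
  show "card (tight v) = DIM(real ^ 'd)" by (simp add: card_tight[OF v])
  show "x = 0" if "\<And>i. i \<in> tight v \<Longrightarrow> U $ i \<bullet> x = 0" for x
    using vertex_separates[OF v] that by blast
next
  fix w
  assume "\<And>i j. i \<in> tight v \<Longrightarrow> j \<in> tight v \<Longrightarrow> U $ i \<bullet> w j = (if i = j then 1 else 0)"
    and "\<And>x. x = (\<Sum>i\<in>tight v. (x \<bullet> w i) *\<^sub>R U $ i)"
    and "\<And>x. x = (\<Sum>i\<in>tight v. (U $ i \<bullet> x) *\<^sub>R w i)"
  then have "dual_at v w" unfolding dual_at_def by blast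
  then show ?thesis by (rule that)
qed

text \<open>The coefficient of \<open>u\<close> at \<open>U $ i\<close> is
  \<open>u \<bullet> w i\<close>, and it is nonnegative because \<open>P\<close> contains a short
  segment from \<open>v\<close> in the direction \<open>w i\<close>. Conversely, each ray at
  \<open>v\<close> attains its minimum over \<open>P\<close> at \<open>v\<close>.\<close>

lemma normal_cone_vertex:
  assumes v: "v \<in> vertices"
  shows "normal_cone P {v} = {\<Sum>i\<in>tight v. c i *\<^sub>R U $ i | c. \<forall>i\<in>tight v. 0 \<le> c i}" (is "_ = ?C")
proof
  obtain w where w: "dual_at v w" using ex_dual_at[OF v] .
  show "normal_cone P {v} \<subseteq> ?C"
  proof
    fix u assume u: "u \<in> normal_cone P {v}"
    have "0 \<le> u \<bullet> w i" if i: "i \<in> tight v" for i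
    proof -
      obtain e where "0 < e" "v + e *\<^sub>R w i \<in> P"
        by (rule feasible_direction[OF vertex_in[OF v], of "w i"]) (simp_all add: dual_at_inner[OF w] i)
      then have "u \<bullet> v \<le> u \<bullet> (v + e *\<^sub>R w i)" using u by (simp add: normal_cone_def)
      then show ?thesis using \<open>0 < e\<close> by (simp add: inner_add_right zero_le_mult_iff)
    qed
    then have "(\<Sum>i\<in>tight v. (u \<bullet> w i) *\<^sub>R U $ i) \<in> ?C"
      by (auto intro!: exI[of _ "\<lambda>i. u \<bullet> w i"])
    then show "u \<in> ?C" unfolding dual_at_expand[OF w, of u, symmetric] .
  qed
  show "?C \<subseteq> normal_cone P {v}"
  proof clarify
    fix c :: "'n \<Rightarrow> real" assume c: "\<forall>i\<in>tight v. 0 \<le> c i"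
    have "U $ i \<bullet> v \<le> U $ i \<bullet> y" if "i \<in> tight v" "y \<in> P" for i y
      using that tight_iff[OF vertex_in[OF v], of i] P_eq by (force simp: ht_def)
    then show "(\<Sum>i\<in>tight v. c i *\<^sub>R U $ i) \<in> normal_cone P {v}"
      using c by (auto simp: normal_cone_def inner_sum_left intro!: sum_mono mult_left_mono)
  qed
qed

text \<open>A linear functional attains its minimum over \<open>P\<close> on a nonempty face, and
  that face has an extreme point.\<close>

lemma normal_cones_cover: "(\<Union>v\<in>vertices. normal_cone P {v}) = UNIV"
proof (intro set_eqI iffI UNIV_I)
  fix u :: "real ^ 'd"
  have cP: "compact P" "P \<noteq> {}"
    using polytope polytope_imp_compact full_dim by (auto simp: aff_dim_empty)
  obtain x where x: "x \<in> P" "\<forall>y\<in>P. u \<bullet> x \<le> u \<bullet> y"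
    using continuous_attains_inf[OF cP, of "\<lambda>y. u \<bullet> y"]
      continuous_on_inner[OF continuous_on_const continuous_on_id] by blast
  let ?T = "P \<inter> {y. u \<bullet> y = u \<bullet> x}"
  have T: "?T face_of P"
    using x by (intro face_of_Int_supporting_hyperplane_ge convex_P) auto
  then have "compact ?T" "convex ?T" "?T \<noteq> {}"
    using face_of_imp_compact cP convex_P face_of_imp_convex x by auto
  then obtain v where "v extreme_point_of ?T" using extreme_point_exists_convex by blast
  then have "v \<in> vertices" "u \<bullet> v = u \<bullet> x"
    using extreme_point_of_face[OF T] by (auto simp: vertices_def)
  then show "u \<in> (\<Union>v\<in>vertices. normal_cone P {v})"
    using x by (intro UN_I[of v]) (simp_all add: normal_cone_def)
qed

text \<open>A functional minimal at both vertices is orthogonal to \<open>v - v'\<close>, so it lies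
  in a hyperplane.\<close>

lemma negligible_normal_cone_Int:
  assumes "v \<in> vertices" "v' \<in> vertices" "v \<noteq> v'"
  shows "negligible (normal_cone P {v} \<inter> normal_cone P {v'})"
proof (rule negligible_subset)
  show "negligible {u. (v - v') \<bullet> u = 0}"
    using assms negligible_hyperplane[of "v - v'" 0] by simp
  have "v \<in> P" "v' \<in> P" using assms vertex_in by auto
  then show "normal_cone P {v} \<inter> normal_cone P {v'} \<subseteq> {u. (v - v') \<bullet> u = 0}"
    by (auto simp: normal_cone_def inner_diff_left inner_commute[of _ v] inner_commute[of _ v'])
       (metis antisym inner_commute)
qed

end

subsection \<open>The adjoint polynomial\<close>

text \<open>These affine forms do for \<open>deformed U z\<close> what the heights
  \<open>ht i\<close> do for \<open>P\<close>.\<close>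

definition form :: "real ^ 'd ^ 'n \<Rightarrow> real ^ 'n \<Rightarrow> 'n \<Rightarrow> real ^ 'd \<Rightarrow> real" where
  "form U z i y = U $ i \<bullet> y + z $ i"

lemma deformed_iff: "y \<in> deformed U z \<longleftrightarrow> (\<forall>i. 0 \<le> form U z i y)"
  by (simp add: deformed_def form_def matrix_vector_mult_def inner_vec_def)

lemma form_diff: "form U z i x - form U z i y = U $ i \<bullet> (x - y)"
  by (simp add: form_def inner_diff_right)

lemma deformed_eq_Inter: "deformed U z = (\<Inter>i. {y. - z $ i \<le> U $ i \<bullet> y})"
proof -
  have "0 \<le> form U z i y \<longleftrightarrow> - z $ i \<le> U $ i \<bullet> y" for i y
    unfolding form_def by linarith
  then show ?thesis by (auto simp: deformed_iff)
qed

lemma convex_deformed: "convex (deformed U z)"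
  unfolding deformed_eq_Inter by (intro convex_INT convex_halfspace_ge)

lemma form_pos_interior:
  assumes "y \<in> interior (deformed U z)" "U $ i \<noteq> 0"
  shows "0 < form U z i y"
proof -
  have "deformed U z \<subseteq> {y. - z $ i \<le> U $ i \<bullet> y}" by (auto simp: deformed_eq_Inter)
  then have "y \<in> interior {y. U $ i \<bullet> y \<ge> - z $ i}" using assms interior_mono by blast
  then show ?thesis using assms(2) by (simp add: form_def)
qed

text \<open>At a relative interior point of \<open>G\<close> some form vanishes, since a proper face
  avoids the interior. The zero set of that form is a face meeting the relative interior of
  \<open>G\<close>, so it contains \<open>G\<close>.\<close>

lemma deformed_facet:
  fixes U :: "real ^ 'd ^ 'n::finite"
  assumes nz: "\<And>i. U $ i \<noteq> 0" and full: "aff_dim (deformed U z) = int CARD('d)"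
    and G: "G facet_of deformed U z"
  shows "\<exists>i. G = {y \<in> deformed U z. form U z i y = 0}"
proof -
  let ?Q = "deformed U z"
  have face: "G face_of ?Q" "convex G" "G \<noteq> {}"
    using G facet_of_imp_face_of face_of_imp_convex by (auto simp: facet_of_def)
  then obtain x where x: "x \<in> rel_interior G" using rel_interior_eq_empty by blast
  then have xG: "x \<in> G" using rel_interior_subset by blast
  have xQ: "x \<in> ?Q" using xG face face_of_imp_subset by blast
  have "G \<noteq> ?Q" using G by auto
  have "\<exists>i. form U z i x = 0"
  proof (rule ccontr)
    assume "\<nexists>i. form U z i x = 0"
    then have pos: "0 < form U z i x" for i using xQ by (metis deformed_iff less_le)
    have "x \<in> interior ?Q"
    proof (rule interiorI)
      show "open (\<Inter>i. {y. U $ i \<bullet> y > - z $ i})"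
        by (intro open_INT finite_UNIV ballI open_halfspace_gt) simp
      show "x \<in> (\<Inter>i. {y. U $ i \<bullet> y > - z $ i})"
      proof
        show "x \<in> {y. U $ i \<bullet> y > - z $ i}" for i using pos[of i] by (simp add: form_def)
      qed
      show "(\<Inter>i. {y. U $ i \<bullet> y > - z $ i}) \<subseteq> ?Q"
        by (auto simp: deformed_eq_Inter less_imp_le)
    qed
    then show False
      using face_of_disjoint_interior[OF face(1) \<open>G \<noteq> ?Q\<close>] xG by blast
  qed
  then obtain i where i: "form U z i x = 0" by blast
  let ?H = "?Q \<inter> {y. U $ i \<bullet> y = - z $ i}"
  have H: "?H face_of ?Q"
    by (intro face_of_Int_supporting_hyperplane_ge convex_deformed) (auto simp: deformed_eq_Inter)
  have "G = ?H"
  proof (rule facet_of_eq_face[OF convex_deformed G H])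
    have "x \<in> ?H" using xQ i by (simp add: form_def eq_neg_iff_add_eq_0)
    then show "G \<subseteq> ?H" using subset_of_face_of[OF H face_of_imp_subset[OF face(1)]] x by blast
    show "?H \<noteq> ?Q" using full_dim_not_in_hyperplane[of ?Q "U $ i" "- z $ i"] full nz by auto
  qed
  also have "?H = {y \<in> ?Q. form U z i y = 0}" by (auto simp: form_def eq_neg_iff_add_eq_0)
  finally show ?thesis by blast
qed

text \<open>Every facet comes from some label, so \<open>CARD('n)\<close> facets use up all labels.
  The denominator of the adjoint is then the product of all the forms.\<close>

lemma facet_rays_eq_UNIV:
  fixes U :: "real ^ 'd ^ 'n::finite"
  assumes nz: "\<And>i. U $ i \<noteq> 0" and full: "aff_dim (deformed U z) = int CARD('d)"
    and card: "card {G. G facet_of deformed U z} = CARD('n)"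
  shows "facet_rays U z = UNIV"
proof -
  have "{G. G facet_of deformed U z} \<subseteq> (\<lambda>i. {y \<in> deformed U z. form U z i y = 0}) ` facet_rays U z"
  proof
    fix G assume "G \<in> {G. G facet_of deformed U z}"
    then obtain i where "G = {y \<in> deformed U z. form U z i y = 0}" "G facet_of deformed U z"
      using deformed_facet[OF nz full] by blast
    then show "G \<in> (\<lambda>i. {y \<in> deformed U z. form U z i y = 0}) ` facet_rays U z"
      by (auto simp: facet_rays_def form_def)
  qed
  then have "CARD('n) \<le> card (facet_rays U z)"
    unfolding card[symmetric] by (rule surj_card_le[OF finite])
  then show ?thesis by (metis card_seteq finite_class.finite_UNIV subset_UNIV)
qed

section \<open>The deformation cone and the volume of the dual body\<close>

context simple_polytope_rays
begin

text \<open>The linear function \<open>g\<close> that agrees with \<open>\<phi>\<close> on the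
  normal cone of \<open>v\<close> gives the point \<open>q\<close>. Convexity makes \<open>g\<close>
  a lower bound of \<open>\<phi>\<close> everywhere, and on the rays this bound says that
  \<open>q\<close> satisfies all the inequalities.\<close>

lemma deformation_vertex:
  assumes z: "z \<in> deformation_cone (normal_fan P) U" and v: "v \<in> vertices"
  obtains q where "q \<in> deformed U z" "\<forall>i\<in>tight v. form U z i q = 0"
proof -
  obtain \<phi> where lin: "\<And>\<sigma>. \<sigma> \<in> normal_fan P \<Longrightarrow> \<exists>g. linear g \<and> (\<forall>u\<in>\<sigma>. \<phi> u = g u)"
    and phi: "\<And>i. \<phi> (U $ i) = z $ i" and cvx: "convex_on UNIV \<phi>"
    using z unfolding deformation_cone_def by blast
  have "normal_cone P {v} \<in> normal_fan P"
    using v by (auto simp: normal_fan_def vertices_def face_of_singleton)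
  then obtain g where g: "linear g" "\<And>u. u \<in> normal_cone P {v} \<Longrightarrow> \<phi> u = g u"
    using lin by blast
  \<comment> \<open>The adjoint at 1 is the vector that represents \<open>g\<close>; the sign turns
    \<open>\<phi> = g\<close> on a ray into the vanishing of its form.\<close>
  define q where "q = - adjoint g 1"
  have gq: "g u = - (u \<bullet> q)" for u using adjoint_works[OF g(1), of u 1] by (simp add: q_def)
  obtain w where w: "dual_at v w" using ex_dual_at[OF v] .
  have ray: "U $ i \<in> normal_cone P {v}" if "i \<in> tight v" for i
  proof -
    have "(\<Sum>j\<in>tight v. (if j = i then 1 else 0) *\<^sub>R U $ j) \<in> normal_cone P {v}"
      unfolding normal_cone_vertex[OF v] by (intro CollectI exI conjI ballI) auto
    moreover have "(\<Sum>j\<in>tight v. (if j = i then 1 else 0) *\<^sub>R U $ j) = (\<Sum>j\<in>tight v. if j = i then U $ j else 0)"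
      by (intro sum.cong) auto
    ultimately show ?thesis using that by simp
  qed
  have "g u \<le> \<phi> u" for u
  proof -
    \<comment> \<open>The point \<open>u0\<close> is interior to the cone, and \<open>t\<close> is
      so small that the point at parameter \<open>t\<close> on the way from \<open>u0\<close> to
      \<open>u\<close> still has nonnegative coordinates. Convexity on this segment bounds
      \<open>\<phi> u\<close> from below.\<close>
    define u0 where "u0 = (\<Sum>i\<in>tight v. U $ i)"
    define t where "t = 1 / (1 + (\<Sum>i\<in>tight v. \<bar>u \<bullet> w i\<bar>))"
    have s: "0 \<le> (\<Sum>i\<in>tight v. \<bar>u \<bullet> w i\<bar>)" by (simp add: sum_nonneg)
    then have t: "0 < t" "t \<le> 1" by (simp_all add: t_def add_pos_nonneg)
    have nonneg: "\<forall>i\<in>tight v. 0 \<le> (1 - t) + t * (u \<bullet> w i)"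
    proof
      fix i assume "i \<in> tight v"
      have "\<bar>u \<bullet> w i\<bar> \<le> (\<Sum>i\<in>tight v. \<bar>u \<bullet> w i\<bar>)"
        using \<open>i \<in> tight v\<close> by (intro member_le_sum) auto
      then have "t * (1 - u \<bullet> w i) \<le> t * (1 + (\<Sum>i\<in>tight v. \<bar>u \<bullet> w i\<bar>))"
        using t by (intro mult_left_mono) auto
      also have "\<dots> = 1" using add_pos_nonneg[OF zero_less_one s] by (simp add: t_def)
      finally show "0 \<le> (1 - t) + t * (u \<bullet> w i)" by (simp add: algebra_simps)
    qed
    have "t *\<^sub>R u = (\<Sum>i\<in>tight v. (t * (u \<bullet> w i)) *\<^sub>R U $ i)"
      using arg_cong[OF dual_at_expand[OF w, of u], of "scaleR t"]
      by (simp only: scaleR_sum_right scaleR_scaleR)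
    then have "(1 - t) *\<^sub>R u0 + t *\<^sub>R u = (\<Sum>i\<in>tight v. ((1 - t) + t * (u \<bullet> w i)) *\<^sub>R U $ i)"
      by (simp add: u0_def scaleR_sum_right sum.distrib scaleR_add_left)
    then have "(1 - t) *\<^sub>R u0 + t *\<^sub>R u \<in> normal_cone P {v}"
      unfolding normal_cone_vertex[OF v] using nonneg
      by (intro CollectI exI[of _ "\<lambda>i. (1 - t) + t * (u \<bullet> w i)"] conjI)
    then have "\<phi> ((1 - t) *\<^sub>R u0 + t *\<^sub>R u) = g ((1 - t) *\<^sub>R u0 + t *\<^sub>R u)" by (rule g(2))
    also have "\<dots> = (1 - t) * g u0 + t * g u"
      using g(1) by (simp add: linear_add linear_cmul)
    finally have eq: "\<phi> ((1 - t) *\<^sub>R u0 + t *\<^sub>R u) = (1 - t) * g u0 + t * g u" .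
    have "u0 \<in> normal_cone P {v}"
      unfolding normal_cone_vertex[OF v] u0_def by (intro CollectI exI[of _ "\<lambda>_. 1"]) auto
    then have "\<phi> u0 = g u0" by (rule g(2))
    moreover have "\<phi> ((1 - t) *\<^sub>R u0 + t *\<^sub>R u) \<le> (1 - t) * \<phi> u0 + t * \<phi> u"
      using convex_onD[OF cvx, of t u0 u] t by simp
    ultimately show ?thesis using eq t by simp
  qed
  then have "- (U $ i \<bullet> q) \<le> z $ i" for i by (metis gq phi)
  then have "q \<in> deformed U z" by (simp add: deformed_iff form_def) (smt (verit))
  moreover have "form U z i q = 0" if "i \<in> tight v" for i
    using g(2)[OF ray[OF that]] by (simp add: phi gq form_def)
  ultimately show ?thesis using that by blast
qed

text \<open>For the labels at a vertex \<open>v\<close> this is the coefficient \<open>D(v)\<close>;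
  it does not involve \<open>z\<close> because the rays enter unscaled.\<close>

definition cone_volume :: "'n set \<Rightarrow> real" where
  "cone_volume I = fact CARD('d) * measure lebesgue (corner_simplex (($) U) (\<lambda>_. 1) I)"

lemma cone_volume_eq:
  assumes "bij_betw e (UNIV :: 'd index_copy set) I"
  shows "cone_volume I = \<bar>corner_det (($) U) e\<bar>"
  using corner_simplex_measure(2)[OF assms, of "\<lambda>_. 1" "($) U"] by (simp add: cone_volume_def)

lemma ex_index_bij:
  fixes I :: "'n set"
  assumes "card I = CARD('d)"
  obtains e where "bij_betw e (UNIV :: 'd index_copy set) I"
  using that finite_same_card_bij[of "UNIV :: 'd index_copy set" I] assms
  by (auto simp: card_index_copy)

text \<open>Over \<open>deformed U z\<close>, a functional from the cone of \<open>v\<close> is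
  minimal at the point \<open>q\<close>, where all forms at \<open>v\<close> vanish. Its membership
  in the dual body is thus the single inequality at \<open>q\<close>, which is the one that defines
  the simplex.\<close>

lemma dual_body_normal_cone:
  assumes z: "z \<in> deformation_cone (normal_fan P) U" and v: "v \<in> vertices"
  shows "dual_body ((\<lambda>w. w - y) ` deformed U z) \<inter> normal_cone P {v} =
    corner_simplex (($) U) (\<lambda>i. form U z i y) (tight v)" (is "?B \<inter> ?N = ?S")
proof (intro subset_antisym subsetI)
  obtain q where q: "q \<in> deformed U z" "\<forall>i\<in>tight v. form U z i q = 0"
    using deformation_vertex[OF z v] .
  have inner: "(\<Sum>i\<in>tight v. c i *\<^sub>R U $ i) \<bullet> (x - y) =
      (\<Sum>i\<in>tight v. c i * form U z i x) - (\<Sum>i\<in>tight v. c i * form U z i y)" for c x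
    by (simp add: inner_sum_left sum_subtractf[symmetric] right_diff_distrib[symmetric] form_diff)
  {
    fix u assume u: "u \<in> ?B \<inter> ?N"
    then obtain c where c: "u = (\<Sum>i\<in>tight v. c i *\<^sub>R U $ i)" "\<forall>i\<in>tight v. 0 \<le> c i"
      unfolding normal_cone_vertex[OF v] by auto
    have "-1 \<le> u \<bullet> (q - y)" using u q(1) by (auto simp: dual_body_def)
    then have "(\<Sum>i\<in>tight v. c i * form U z i y) \<le> 1" unfolding c(1) inner by (simp add: q(2))
    then show "u \<in> ?S" unfolding corner_simplex_def using c by blast
  }
  fix u assume "u \<in> ?S"
  then obtain c where c: "u = (\<Sum>i\<in>tight v. c i *\<^sub>R U $ i)" "\<forall>i\<in>tight v. 0 \<le> c i"
    "(\<Sum>i\<in>tight v. c i * form U z i y) \<le> 1"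
    unfolding corner_simplex_def by auto
  have "-1 \<le> u \<bullet> (x - y)" if "x \<in> deformed U z" for x
  proof -
    have "0 \<le> (\<Sum>i\<in>tight v. c i * form U z i x)"
      using that c(2) by (intro sum_nonneg) (simp add: deformed_iff)
    then show ?thesis unfolding c(1) inner using c(3) by simp
  qed
  then show "u \<in> ?B \<inter> ?N"
    using c unfolding normal_cone_vertex[OF v] by (auto simp: dual_body_def)
qed

text \<open>The normal cones cover the space and overlap in null sets, so the volumes of the
  simplices add up.\<close>

lemma normalized_vol_dual_body:
  assumes z: "z \<in> deformation_cone (normal_fan P) U" and pos: "\<And>i. 0 < form U z i y"
  shows "normalized_vol (dual_body ((\<lambda>w. w - y) ` deformed U z)) =
    (\<Sum>v\<in>vertices. cone_volume (tight v) / (\<Prod>i\<in>tight v. form U z i y))"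
proof -
  let ?B = "dual_body ((\<lambda>w. w - y) ` deformed U z)"
  let ?S = "\<lambda>v. corner_simplex (($) U) (\<lambda>i. form U z i y) (tight v)"
  have S: "?S v = ?B \<inter> normal_cone P {v}" if "v \<in> vertices" for v
    using dual_body_normal_cone[OF z that] by simp
  have m: "?S v \<in> lmeasurable"
    "fact CARD('d) * measure lebesgue (?S v) = cone_volume (tight v) / (\<Prod>i\<in>tight v. form U z i y)"
    if v: "v \<in> vertices" for v
  proof -
    obtain e where e: "bij_betw e (UNIV :: 'd index_copy set) (tight v)"
      using ex_index_bij[OF card_tight[OF v]] .
    show "?S v \<in> lmeasurable"
      "fact CARD('d) * measure lebesgue (?S v) = cone_volume (tight v) / (\<Prod>i\<in>tight v. form U z i y)"
      using corner_simplex_measure[OF e, of "\<lambda>i. form U z i y" "($) U"] pos cone_volume_eq[OF e] by auto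
  qed
  have "?B = (\<Union>v\<in>vertices. ?B \<inter> normal_cone P {v})" using normal_cones_cover by blast
  also have "\<dots> = (\<Union>v\<in>vertices. ?S v)" using S by simp
  finally have "measure lebesgue ?B = measure lebesgue (\<Union>v\<in>vertices. ?S v)" by simp
  also have "\<dots> = (\<Sum>v\<in>vertices. measure lebesgue (?S v))"
  proof (rule measure_negligible_finite_Union_image[OF finite_vertices m(1)])
    show "pairwise (\<lambda>v v'. negligible (?S v \<inter> ?S v')) vertices"
      unfolding pairwise_def
      using negligible_subset[OF negligible_normal_cone_Int] S by (metis Int_lower2 Int_mono)
  qed
  finally show ?thesis
    unfolding normalized_vol_def using m(2) by (simp add: sum_distrib_left)
qed

text \<open>Clearing denominators in the volume formula leaves a polynomial, and uniqueness on the
  interior identifies it with the adjoint.\<close>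

lemma adj_eq:
  assumes z: "z \<in> deformation_cone (normal_fan P) U"
    and full: "aff_dim (deformed U z) = int CARD('d)"
    and card: "card {G. G facet_of deformed U z} = CARD('n)"
  shows "adj U z y = (\<Sum>v\<in>vertices. cone_volume (tight v) * (\<Prod>i\<in>- tight v. form U z i y))"
proof -
  let ?p = "\<lambda>y. \<Sum>v\<in>vertices. cone_volume (tight v) * (\<Prod>i\<in>- tight v. form U z i y)"
  let ?Q = "interior (deformed U z)"
  let ?vol = "\<lambda>y. normalized_vol (dual_body ((\<lambda>w. w - y) ` deformed U z))"
  have UNIV: "facet_rays U z = UNIV" using facet_rays_eq_UNIV[OF ray_nonzero full card] .
  have pos: "0 < form U z i y" if "y \<in> ?Q" for i y using form_pos_interior[OF that ray_nonzero] .
  have prod: "(\<Prod>i\<in>facet_rays U z. U $ i \<bullet> y + z $ i) = (\<Prod>i\<in>UNIV. form U z i y)" for y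
    by (simp add: UNIV form_def)
  have poly: "real_polynomial_function ?p"
    unfolding form_def
    by (intro real_polynomial_function_sum real_polynomial_function_prod finite_vertices finite
        real_polynomial_function.intros bounded_linear_inner_right)
  have vol: "?vol y = ?p y / (\<Prod>i\<in>UNIV. form U z i y)" if y: "y \<in> ?Q" for y
  proof -
    have "cone_volume (tight v) / (\<Prod>i\<in>tight v. form U z i y) =
       cone_volume (tight v) * (\<Prod>i\<in>- tight v. form U z i y) / (\<Prod>i\<in>UNIV. form U z i y)" for v
    proof -
      have "(\<Prod>i\<in>UNIV. form U z i y) = (\<Prod>i\<in>tight v. form U z i y) * (\<Prod>i\<in>- tight v. form U z i y)"
        using prod.union_disjoint[of "tight v" "- tight v" "\<lambda>i. form U z i y"] by simp
      moreover have "(\<Prod>i\<in>- tight v. form U z i y) \<noteq> 0"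
        using pos[OF y] by (simp add: less_imp_neq[symmetric])
      ultimately show ?thesis by simp
    qed
    then show ?thesis
      using normalized_vol_dual_body[OF z pos[OF y]] by (simp add: sum_divide_distrib)
  qed
  have "deformed U z \<noteq> {}" using full by auto
  \<comment> \<open>The uniqueness argument needs a nonempty open set, which full dimension
    provides.\<close>
  then have "?Q \<noteq> {}"
    using full interior_rel_interior_gen[of "deformed U z"] rel_interior_eq_empty[OF convex_deformed, of U z]
    by simp
  have "adj U z = ?p"
    unfolding adj_def prod
  proof (rule the_equality)
    show "real_polynomial_function ?p \<and> (\<forall>y\<in>?Q. ?vol y = ?p y / (\<Prod>i\<in>UNIV. form U z i y))"
      using poly vol by blast
  next
    fix p assume p: "real_polynomial_function p \<and> (\<forall>y\<in>?Q. ?vol y = p y / (\<Prod>i\<in>UNIV. form U z i y))"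
    have "p y = ?p y" if y: "y \<in> ?Q" for y
    proof -
      have "(\<Prod>i\<in>UNIV. form U z i y) \<noteq> 0"
        using pos[OF y] by (simp add: less_imp_neq[symmetric])
      moreover have "?vol y = p y / (\<Prod>i\<in>UNIV. form U z i y)" using p y by blast
      then have "p y / (\<Prod>i\<in>UNIV. form U z i y) = ?p y / (\<Prod>i\<in>UNIV. form U z i y)"
        using vol[OF y] by (rule trans[OF sym])
      ultimately show ?thesis by simp
    qed
    then show "p = ?p"
      using real_polynomial_function_eq_on_open[OF _ poly open_interior \<open>?Q \<noteq> {}\<close>] p by blast
  qed
  then show ?thesis by simp
qed

end

subsection \<open>Simplex faces\<close>

text \<open>\<open>C\<close> is the vertex set of the simplex \<Delta>; having at least two vertices
  means positive dimension.\<close>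

locale simplex_face = simple_polytope_rays P F U
  for P :: "(real ^ 'd) set" and F :: "'n::finite \<Rightarrow> (real ^ 'd) set" and U :: "real ^ 'd ^ 'n" +
  fixes C :: "(real ^ 'd) set"
  assumes indep: "\<not> affine_dependent C" and card_C: "2 \<le> card C"
    and face: "convex hull C face_of P"
begin

abbreviation \<tau> :: "'n set" where "\<tau> \<equiv> cone_rays F (convex hull C)"
abbreviation N :: "'n set" where "N \<equiv> nb F (convex hull C)"

lemma finite_C: "finite C" using indep by (rule aff_independent_finite)

lemma ex_other: obtains x where "x \<in> C" "x \<noteq> c"
proof -
  have "\<not> C \<subseteq> {c}" using card_C card_mono[of "{c}" C] by auto
  then show ?thesis using that by blast
qed

lemma C_in: "c \<in> C \<Longrightarrow> c \<in> P"
  using face_of_imp_subset[OF face] hull_subset[of C convex] by blast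

lemma C_vertex: "c \<in> C \<Longrightarrow> c \<in> vertices"
  using extreme_point_of_face[OF face] extreme_point_of_convex_hull_affine_independent[OF indep]
  by (simp add: vertices_def)

lemma ht_\<tau>: "i \<in> \<tau> \<Longrightarrow> c \<in> C \<Longrightarrow> ht i c = 0"
  using ht_facet hull_subset[of C convex] by (auto simp: cone_rays_def)

lemma \<tau>_tight: "c \<in> C \<Longrightarrow> \<tau> \<subseteq> tight c"
  using hull_subset[of C convex] by (auto simp: cone_rays_def tight_def)

lemma ht_convex:
  assumes "sum b C = 1"
  shows "ht i (\<Sum>x\<in>C. b x *\<^sub>R x) = (\<Sum>x\<in>C. b x * ht i x)"
  using assms by (simp add: ht_def inner_sum_right right_diff_distrib sum_subtractf flip: sum_distrib_right)

text \<open>A proper nonempty face of a polyhedron is the intersection of the facets that contain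
  it.\<close>

lemma face_characterization:
  assumes y: "y \<in> P" and i: "\<And>i. i \<in> \<tau> \<Longrightarrow> y \<in> F i"
  shows "y \<in> convex hull C"
proof (cases "convex hull C = P")
  case False
  have "convex hull C \<noteq> {}" using card_C by auto
  then have "convex hull C = \<Inter>{G. G facet_of P \<and> convex hull C \<subseteq> G}"
    using face_of_polyhedron[OF polyhedron face _ False] by blast
  moreover have "y \<in> G" if "G facet_of P" "convex hull C \<subseteq> G" for G
    using facetE[OF that(1)] that(2) i by (auto simp: cone_rays_def)
  ultimately show ?thesis by blast
qed (use y in simp)

text \<open>This discards the vertices outside \<Delta>: each of them misses a facet in
  \<open>\<tau>\<close>, whose form then occurs as a factor in its summand.\<close>

lemma vertex_of_face_iff:
  assumes v: "v \<in> vertices"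
  shows "\<tau> \<subseteq> tight v \<longleftrightarrow> v \<in> C"
proof
  assume "\<tau> \<subseteq> tight v"
  then have "v \<in> convex hull C"
    by (intro face_characterization vertex_in[OF v]) (auto simp: tight_def)
  then show "v \<in> C"
    using v extreme_point_of_face[OF face] extreme_point_of_convex_hull_affine_independent[OF indep]
    by (auto simp: vertices_def)
qed (rule \<tau>_tight)

text \<open>
  The edges of \<open>P\<close> at \<open>c\<close> have the directions \<open>w i\<close>.  A point of such an edge is a convex combination
  of \<open>C\<close>, and since heights are nonnegative no vertex of positive weight leaves the facets
  other than \<open>i\<close> that contain \<open>c\<close>.
\<close>

lemma edge_direction:
  assumes c: "c \<in> C" and w: "dual_at c w" and i: "i \<in> tight c - \<tau>"
  shows "\<exists>x. x \<in> C \<and> 0 < ht i x \<and> x - c = ht i x *\<^sub>R w i"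
proof -
  have cP: "c \<in> P" using C_in[OF c] .
  have hc: "ht j c = 0" if "j \<in> tight c" for j using tight_iff[OF cP] that by simp
  obtain e where e: "0 < e" "c + e *\<^sub>R w i \<in> P"
    using i by (auto intro: feasible_direction[OF cP, of "w i"] simp: dual_at_inner[OF w])
  have hj: "ht j (c + e *\<^sub>R w i) = (if j = i then e else 0)" if "j \<in> tight c" for j
  proof -
    have "ht j (c + e *\<^sub>R w i) = ht j c + e * (U $ j \<bullet> w i)"
      by (simp add: ht_def inner_add_right)
    then show ?thesis using i that by (simp add: hc dual_at_inner[OF w])
  qed
  have "c + e *\<^sub>R w i \<in> convex hull C"
  proof (rule face_characterization[OF e(2)])
    fix j assume j: "j \<in> \<tau>"
    then have "j \<in> tight c" "j \<noteq> i" using \<tau>_tight[OF c] i by auto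
    then have "ht j (c + e *\<^sub>R w i) = 0" using hj[of j] by simp
    then show "c + e *\<^sub>R w i \<in> F j" using e(2) facet_eq by blast
  qed
  then obtain b where b: "\<forall>x\<in>C. 0 \<le> b x" "sum b C = 1" "(\<Sum>x\<in>C. b x *\<^sub>R x) = c + e *\<^sub>R w i"
    unfolding convex_hull_finite[OF finite_C] by blast
  have sums: "(\<Sum>x\<in>C. b x * ht j x) = (if j = i then e else 0)" if "j \<in> tight c" for j
    using ht_convex[OF b(2), of j] hj[OF that] b(3) by simp
  have nn: "0 \<le> b x * ht j x" if "x \<in> C" for x j
    using that b(1) ht_nonneg[OF C_in[OF that]] by simp
  have "(\<Sum>x\<in>C. b x * ht i x) \<noteq> 0" using sums[of i] i e(1) by simp
  then obtain x where x: "x \<in> C" "b x * ht i x \<noteq> 0" by (meson sum.neutral)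
  then have bx: "b x \<noteq> 0" and pos: "0 < ht i x"
    using ht_nonneg[OF C_in[OF x(1)], of i] by auto
  have z: "ht j x = 0" if "j \<in> tight c" "j \<noteq> i" for j
  proof -
    have "b x * ht j x = 0"
      using sums[OF that(1)] that(2) sum_nonneg_eq_0_iff[OF finite_C, of "\<lambda>x. b x * ht j x"] nn x(1) by simp
    then show ?thesis using bx by simp
  qed
  have "x - c = (\<Sum>j\<in>tight c. (U $ j \<bullet> (x - c)) *\<^sub>R w j)" using dual_at_expand'[OF w] .
  also have "\<dots> = (\<Sum>j\<in>tight c. if j = i then ht i x *\<^sub>R w i else 0)"
    by (intro sum.cong) (auto simp: ht_diff[symmetric] hc z)
  also have "\<dots> = ht i x *\<^sub>R w i" using i by simp
  finally show ?thesis using x(1) pos by blast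
qed

text \<open>The edges at \<open>c\<close> inside \<Delta> end in the other vertices. Distinct labels
  have distinct ends because \<open>ht i\<close> is positive only at \<open>\<theta> i\<close>. A
  vertex missed by \<open>\<theta>\<close> would lie in the affine hull of the rest of
  \<open>C\<close>.\<close>

lemma edge_bijection:
  assumes c: "c \<in> C" and w: "dual_at c w"
  obtains \<theta> where "bij_betw \<theta> (tight c - \<tau>) (C - {c})"
    and "\<forall>i\<in>tight c - \<tau>. 0 < ht i (\<theta> i) \<and> \<theta> i - c = ht i (\<theta> i) *\<^sub>R w i \<and> (\<forall>x\<in>C - {\<theta> i}. ht i x = 0)"
proof -
  obtain \<theta> where \<theta>: "\<And>i. i \<in> tight c - \<tau> \<Longrightarrow> \<theta> i \<in> C"
    "\<And>i. i \<in> tight c - \<tau> \<Longrightarrow> 0 < ht i (\<theta> i)"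
    "\<And>i. i \<in> tight c - \<tau> \<Longrightarrow> \<theta> i - c = ht i (\<theta> i) *\<^sub>R w i"
    using edge_direction[OF c w] by metis
  have hc: "ht j c = 0" if "j \<in> tight c" for j using tight_iff[OF C_in[OF c]] that by simp
  have h\<theta>: "ht i (\<theta> j) = 0" if "i \<in> tight c" "j \<in> tight c - \<tau>" "i \<noteq> j" for i j
  proof -
    have "ht i (\<theta> j) = U $ i \<bullet> (\<theta> j - c)" by (simp add: ht_diff[symmetric] hc that)
    also have "\<dots> = 0" using \<theta>(3)[OF that(2)] that dual_at_inner[OF w, of i j] by simp
    finally show ?thesis .
  qed
  have surj: "x \<in> \<theta> ` (tight c - \<tau>)" if x: "x \<in> C" "x \<noteq> c" for x
  proof (rule ccontr)
    assume no: "x \<notin> \<theta> ` (tight c - \<tau>)"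
    let ?S = "(\<lambda>y. - c + y) ` (C - {x} - {c})"
    have "x - c = (\<Sum>j\<in>tight c. (U $ j \<bullet> (x - c)) *\<^sub>R w j)" using dual_at_expand'[OF w] .
    \<comment> \<open>Both \<open>x\<close> and \<open>c\<close> lie on the facets in
      \<open>\<tau>\<close>, so these terms vanish.\<close>
    also have "\<dots> = (\<Sum>j\<in>tight c - \<tau>. (U $ j \<bullet> (x - c)) *\<^sub>R w j)"
      using ht_\<tau>[OF _ x(1)] ht_\<tau>[OF _ c] by (intro sum.mono_neutral_right) (auto simp: ht_diff[symmetric])
    also have "\<dots> \<in> span ?S"
    proof (intro span_sum span_scale)
      fix j assume j: "j \<in> tight c - \<tau>"
      have "\<theta> j \<noteq> c" using \<theta>(2)[OF j] hc j by force
      moreover have "\<theta> j \<noteq> x" using no j by blast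
      ultimately have "\<theta> j - c \<in> ?S" using \<theta>(1)[OF j] by auto
      then have "(1 / ht j (\<theta> j)) *\<^sub>R (\<theta> j - c) \<in> span ?S" by (intro span_scale span_base)
      moreover have "(1 / ht j (\<theta> j)) *\<^sub>R (\<theta> j - c) = w j" using \<theta>(2)[OF j] unfolding \<theta>(3)[OF j] by simp
      ultimately show "w j \<in> span ?S" by simp
    qed
    finally have "x \<in> (\<lambda>v. c + v) ` span ?S" by (force simp: image_iff)
    then have "x \<in> affine hull (C - {x})" using affine_hull_span2[of c "C - {x}"] c x(2) by simp
    then show False using indep x(1) by (auto simp: affine_dependent_def)
  qed
  have ne: "\<theta> i \<noteq> c" if "i \<in> tight c - \<tau>" for i using \<theta>(2)[OF that] hc that by force
  have inj: "inj_on \<theta> (tight c - \<tau>)"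
    using h\<theta> \<theta>(2) by (intro inj_onI) (metis DiffD1 less_irrefl)
  have "\<theta> ` (tight c - \<tau>) = C - {c}" using surj \<theta>(1) ne by blast
  then have bij: "bij_betw \<theta> (tight c - \<tau>) (C - {c})" using inj by (simp add: bij_betw_def)
  have "ht i x = 0" if i: "i \<in> tight c - \<tau>" and x: "x \<in> C - {\<theta> i}" for i x
  proof (cases "x = c")
    case False
    then obtain j where "j \<in> tight c - \<tau>" "x = \<theta> j" using surj x by blast
    then show ?thesis using h\<theta>[of i j] i x by auto
  qed (use hc i in simp)
  then show ?thesis using bij \<theta> that by blast
qed

text \<open>In a convex combination of \<open>C\<close> only \<open>x\<close> contributes to
  \<open>ht i\<close>, so height zero forces its weight to be zero.\<close>

lemma facet_of_face:
  assumes x: "x \<in> C" "0 < ht i x" and others: "\<And>y. y \<in> C - {x} \<Longrightarrow> ht i y = 0"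
  shows "F i \<inter> convex hull C = convex hull (C - {x})"
proof
  have "C - {x} \<subseteq> F i \<inter> convex hull C"
    using others C_in hull_subset[of C convex] by (auto simp: facet_eq)
  moreover have "convex (F i \<inter> convex hull C)"
    by (intro convex_Int convex_convex_hull face_of_imp_convex[OF facet_of_imp_face_of[OF facet]])
  ultimately show "convex hull (C - {x}) \<subseteq> F i \<inter> convex hull C" by (rule hull_minimal)
  show "F i \<inter> convex hull C \<subseteq> convex hull (C - {x})"
  proof
    fix y assume y: "y \<in> F i \<inter> convex hull C"
    then obtain b where b: "\<forall>x\<in>C. 0 \<le> b x" "sum b C = 1" "(\<Sum>x\<in>C. b x *\<^sub>R x) = y"
      unfolding convex_hull_finite[OF finite_C] by blast
    have "0 = ht i y" using y ht_facet by simp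
    also have "\<dots> = (\<Sum>x\<in>C. b x * ht i x)" using ht_convex[OF b(2)] b(3) by simp
    also have "\<dots> = b x * ht i x"
      using others by (subst sum.remove[OF finite_C x(1)]) simp
    finally have "b x = 0" using x(2) by simp
    then have "sum b (C - {x}) = 1" "(\<Sum>x\<in>C - {x}. b x *\<^sub>R x) = y"
      using b(2,3) by (simp_all add: sum.remove[OF finite_C x(1)])
    then show "y \<in> convex hull (C - {x})"
      using b(1) finite_C by (subst convex_hull_finite) auto
  qed
qed

section \<open>Neighbouring facets and their opposite vertices\<close>

text \<open>A facet of a simplex omits exactly one vertex, and another vertex serves as
  \<open>c\<close>. Conversely, the facet of \<Delta> cut out by \<open>F i\<close> omits the end
  \<open>\<theta> i\<close> of the edge at \<open>c\<close> that leaves \<open>F i\<close>.\<close>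

lemma nb_iff: "i \<in> N \<longleftrightarrow> (\<exists>c\<in>C. i \<in> tight c - \<tau>)"
proof
  assume "i \<in> N"
  then have f: "F i \<inter> convex hull C facet_of convex hull C" by (simp add: nb_def)
  then obtain u where u: "F i \<inter> convex hull C = convex hull (C - {u})" "F i \<inter> convex hull C \<noteq> {}"
    using facet_of_convex_hull_affine_independent[OF indep] by blast
  then have "C - {u} \<noteq> {}" by auto
  then obtain c where c: "c \<in> C - {u}" by blast
  then have "c \<in> F i" using u(1) hull_subset[of "C - {u}" convex] by blast
  moreover have "i \<notin> \<tau>" using f facet_of_irrefl by (auto simp: cone_rays_def inf_absorb2)
  ultimately show "\<exists>c\<in>C. i \<in> tight c - \<tau>" using c by (auto simp: tight_def)
next
  assume "\<exists>c\<in>C. i \<in> tight c - \<tau>"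
  then obtain c where c: "c \<in> C" "i \<in> tight c - \<tau>" by blast
  obtain w where w: "dual_at c w" using ex_dual_at[OF C_vertex[OF c(1)]] .
  obtain \<theta> where b: "bij_betw \<theta> (tight c - \<tau>) (C - {c})"
    and \<theta>: "\<forall>i\<in>tight c - \<tau>. 0 < ht i (\<theta> i) \<and> \<theta> i - c = ht i (\<theta> i) *\<^sub>R w i \<and> (\<forall>x\<in>C - {\<theta> i}. ht i x = 0)"
    using edge_bijection[OF c(1) w] .
  have t: "\<theta> i \<in> C - {c}" using b c(2) bij_betwE by blast
  then have "F i \<inter> convex hull C = convex hull (C - {\<theta> i})"
    using \<theta> c(2) by (intro facet_of_face) auto
  moreover have "convex hull (C - {\<theta> i}) \<noteq> {}" using c(1) t by auto
  ultimately show "i \<in> N"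
    unfolding nb_def using facet_of_convex_hull_affine_independent[OF indep] t by blast
qed

text \<open>This pairs the neighbouring facets with the vertices of \<Delta>: \<open>c\<close> is
  the only vertex off \<open>F i\<close>.\<close>

definition opposite :: "'n \<Rightarrow> real ^ 'd \<Rightarrow> bool" where
  "opposite i c \<longleftrightarrow> i \<in> N \<and> c \<in> C \<and> 0 < ht i c \<and> (\<forall>x\<in>C - {c}. ht i x = 0)"

lemma opposite_edge:
  assumes c: "c \<in> C" and w: "dual_at c w"
  obtains \<theta> where "bij_betw \<theta> (tight c - \<tau>) (C - {c})"
    and "\<forall>i\<in>tight c - \<tau>. opposite i (\<theta> i) \<and> \<theta> i - c = ht i (\<theta> i) *\<^sub>R w i"
proof -
  obtain \<theta> where b: "bij_betw \<theta> (tight c - \<tau>) (C - {c})"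
    and \<theta>: "\<forall>i\<in>tight c - \<tau>. 0 < ht i (\<theta> i) \<and> \<theta> i - c = ht i (\<theta> i) *\<^sub>R w i \<and> (\<forall>x\<in>C - {\<theta> i}. ht i x = 0)"
    using edge_bijection[OF c w] .
  have "opposite i (\<theta> i)" if i: "i \<in> tight c - \<tau>" for i
    unfolding opposite_def using \<theta> i nb_iff c bij_betwE[OF b] by blast
  then show ?thesis using that b \<theta> by blast
qed

text \<open>Seen from another vertex \<open>c1\<close>, both facets pass through \<open>c1\<close>
  and their edges end in \<open>c\<close>; the edge map at \<open>c1\<close> is injective.\<close>

lemma opposite_inj:
  assumes "opposite i c" "opposite j c"
  shows "i = j"
proof -
  obtain c1 where c1: "c1 \<in> C" "c1 \<noteq> c" using ex_other .
  obtain w where w: "dual_at c1 w" using ex_dual_at[OF C_vertex[OF c1(1)]] .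
  obtain \<theta> where b: "bij_betw \<theta> (tight c1 - \<tau>) (C - {c1})"
    and \<theta>: "\<forall>i\<in>tight c1 - \<tau>. opposite i (\<theta> i) \<and> \<theta> i - c1 = ht i (\<theta> i) *\<^sub>R w i"
    using opposite_edge[OF c1(1) w] .
  have "l \<in> tight c1 - \<tau> \<and> \<theta> l = c" if l: "opposite l c" for l
  proof -
    have "l \<in> tight c1" using l c1 tight_iff[OF C_in[OF c1(1)]] by (auto simp: opposite_def)
    moreover have "l \<notin> \<tau>" using l by (auto simp: opposite_def dest: ht_\<tau>)
    ultimately have "l \<in> tight c1 - \<tau>" by blast
    moreover have "opposite l (\<theta> l)" using \<theta> calculation by blast
    then have "\<theta> l = c" using l unfolding opposite_def by force
    ultimately show ?thesis by blast
  qed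
  then show ?thesis using assms b unfolding bij_betw_def inj_on_def by metis
qed

lemma ex_opposite_vertex:
  assumes "i \<in> N" obtains c where "opposite i c"
proof -
  obtain c where c: "c \<in> C" "i \<in> tight c - \<tau>" using assms nb_iff by blast
  obtain w where w: "dual_at c w" using ex_dual_at[OF C_vertex[OF c(1)]] .
  show ?thesis using opposite_edge[OF c(1) w] c(2) that by metis
qed

lemma ex_opposite_facet:
  assumes c: "c \<in> C" obtains i where "opposite i c"
proof -
  obtain c1 where c1: "c1 \<in> C" "c1 \<noteq> c" using ex_other .
  obtain w where w: "dual_at c1 w" using ex_dual_at[OF C_vertex[OF c1(1)]] .
  obtain \<theta> where b: "bij_betw \<theta> (tight c1 - \<tau>) (C - {c1})"
    and \<theta>: "\<forall>i\<in>tight c1 - \<tau>. opposite i (\<theta> i) \<and> \<theta> i - c1 = ht i (\<theta> i) *\<^sub>R w i"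
    using opposite_edge[OF c1(1) w] .
  have "c \<in> \<theta> ` (tight c1 - \<tau>)" using b c c1 by (auto simp: bij_betw_def)
  then show ?thesis using \<theta> that by blast
qed

text \<open>Every other neighbouring facet is opposite to a different vertex, so it passes through
  \<open>c\<close>.\<close>

lemma opposite_tight:
  assumes j: "opposite j c"
  shows "tight c = \<tau> \<union> N - {j}" "j \<notin> tight c"
proof -
  have c: "c \<in> C" using j by (simp add: opposite_def)
  show nt: "j \<notin> tight c" using j tight_iff[OF C_in[OF c]] by (auto simp: opposite_def)
  have "i \<in> tight c" if i: "i \<in> N" "i \<noteq> j" for i
  proof -
    obtain x where x: "opposite i x" using ex_opposite_vertex[OF i(1)] .
    then have "x \<noteq> c" using opposite_inj[OF _ j] i(2) by blast
    then have "ht i c = 0" using x c by (simp add: opposite_def)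
    then show ?thesis using tight_iff[OF C_in[OF c]] by simp
  qed
  then show "tight c = \<tau> \<union> N - {j}"
    using nt \<tau>_tight[OF c] nb_iff c by blast
qed

text \<open>The rays at \<open>x\<close> arise from those at \<open>c\<close> by exchanging
  \<open>i\<close> for \<open>j\<close>, which multiplies the determinant by
  \<open>U $ j \<bullet> w i\<close>. This factor is negative because \<open>ht j\<close> falls from
  a positive value at \<open>c\<close> to zero at \<open>x\<close>.\<close>

lemma adjacent_cone:
  assumes c: "c \<in> C" and w: "dual_at c w" and j: "opposite j c"
    and x: "opposite i x" "x - c = ht i x *\<^sub>R w i" and i: "i \<in> tight c - \<tau>"
  shows "cone_volume (tight x) = - (U $ j \<bullet> w i) * cone_volume (tight c)"
proof -
  have xc: "x \<noteq> c" using x(1) i tight_iff[OF C_in[OF c], of i] by (auto simp: opposite_def)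
  have hx: "0 < ht i x" using x(1) by (simp add: opposite_def)
  have "ht j x = 0" using j x(1) xc by (auto simp: opposite_def)
  then have "ht i x * (U $ j \<bullet> w i) = - ht j c"
    using ht_diff[of j x c] by (simp add: x(2))
  moreover have "0 < ht j c" using j by (simp add: opposite_def)
  ultimately have neg: "U $ j \<bullet> w i < 0"
    using hx mult_nonneg_nonneg[of "ht i x" "U $ j \<bullet> w i"] by linarith
  obtain e where e: "bij_betw e (UNIV :: 'd index_copy set) (tight c)"
    using ex_index_bij[OF card_tight[OF C_vertex[OF c]]] .
  then obtain r where r: "e r = i" using i unfolding bij_betw_def by (metis DiffD1 imageE)
  have "tight x = insert j (tight c - {i})"
    using opposite_tight[OF j] opposite_tight[OF x(1)] j x(1) i xc opposite_inj[OF x(1)]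
    by (auto simp: opposite_def)
  moreover have "bij_betw (e(r := j)) UNIV (insert j (tight c - {i}))"
    using e r opposite_tight(2)[OF j] unfolding bij_betw_def inj_on_def
    by (auto simp: image_iff) (metis UNIV_I image_iff)+
  ultimately have "cone_volume (tight x) = \<bar>corner_det (($) U) (e(r := j))\<bar>"
    using cone_volume_eq by metis
  also have "\<dots> = \<bar>(U $ j \<bullet> w i) * corner_det (($) U) e\<bar>"
    using corner_det_replace[OF e r, of "($) U" j "\<lambda>l. U $ j \<bullet> w l"] dual_at_expand[OF w, of "U $ j"]
    by simp
  finally show ?thesis using neg by (simp add: abs_mult cone_volume_eq[OF e])
qed

lemma cone_volume_sum_eq_0:
  assumes q: "\<And>i. i \<in> \<tau> \<union> N \<Longrightarrow> form U z i q = 0" and y: "\<And>i. i \<in> \<tau> \<Longrightarrow> form U z i y = 0"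
  shows "(\<Sum>v\<in>vertices. cone_volume (tight v) * (\<Prod>i\<in>- tight v. form U z i y)) = 0"
proof -
  let ?t = "\<lambda>v. cone_volume (tight v) * (\<Prod>i\<in>- tight v. form U z i y)"
  let ?f = "\<lambda>i. form U z i y" and ?R = "\<Prod>i\<in>- (\<tau> \<union> N). form U z i y"
  have "?t v = 0" if v: "v \<in> vertices - C" for v
  proof -
    obtain i where "i \<in> \<tau>" "i \<notin> tight v" using vertex_of_face_iff[of v] v by blast
    then show ?thesis using y[of i] by (auto intro!: prod_zero)
  qed
  then have reduce: "sum ?t vertices = sum ?t C"
    using C_vertex finite_vertices by (intro sum.mono_neutral_right) auto
  obtain c where c: "c \<in> C" using ex_other by blast
  obtain w where w: "dual_at c w" using ex_dual_at[OF C_vertex[OF c]] .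
  obtain j where j: "opposite j c" using ex_opposite_facet[OF c] .
  obtain \<theta> where b: "bij_betw \<theta> (tight c - \<tau>) (C - {c})"
    and \<theta>: "\<forall>i\<in>tight c - \<tau>. opposite i (\<theta> i) \<and> \<theta> i - c = ht i (\<theta> i) *\<^sub>R w i"
    using opposite_edge[OF c w] .
  \<comment> \<open>Each vertex of \<Delta> misses its opposite facet and the facets outside
    \<open>\<tau> \<union> N\<close>, so all summands share the factor \<open>?R\<close>.\<close>
  have prod: "(\<Prod>i\<in>- tight x. ?f i) = ?f i * ?R" if x: "opposite i x" for i x
  proof -
    have "- tight x = insert i (- (\<tau> \<union> N))" "i \<notin> - (\<tau> \<union> N)"
      using opposite_tight(1)[OF x] x by (auto simp: opposite_def)
    then show ?thesis by simp
  qed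
  have "sum ?t (C - {c}) = (\<Sum>i\<in>tight c - \<tau>. ?t (\<theta> i))"
    by (rule sum.reindex_bij_betw[OF b, symmetric])
  also have "\<dots> = (\<Sum>i\<in>tight c - \<tau>. - (cone_volume (tight c) * ?R) * ((U $ j \<bullet> w i) * ?f i))"
  proof (intro sum.cong refl)
    fix i assume i: "i \<in> tight c - \<tau>"
    then have o: "opposite i (\<theta> i)" and "\<theta> i - c = ht i (\<theta> i) *\<^sub>R w i" using \<theta> by blast+
    then have "cone_volume (tight (\<theta> i)) = - (U $ j \<bullet> w i) * cone_volume (tight c)"
      using adjacent_cone[OF c w j _ _ i] by blast
    then show "?t (\<theta> i) = - (cone_volume (tight c) * ?R) * ((U $ j \<bullet> w i) * ?f i)"
      unfolding prod[OF o] by (simp only: mult_minus_left mult_minus_right mult_ac)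
  qed
  also have "\<dots> = - (cone_volume (tight c) * ?R) * (\<Sum>i\<in>tight c - \<tau>. (U $ j \<bullet> w i) * ?f i)"
    by (simp add: sum_distrib_left)
  \<comment> \<open>The forms in \<open>\<tau>\<close> vanish at \<open>y\<close>, so the sum
    extends to the full basis of rays at \<open>c\<close>.\<close>
  also have "(\<Sum>i\<in>tight c - \<tau>. (U $ j \<bullet> w i) * ?f i) = (\<Sum>i\<in>tight c. (U $ j \<bullet> w i) * ?f i)"
    using y by (intro sum.mono_neutral_left) auto
  \<comment> \<open>Subtracting the zero value at \<open>q\<close> makes the forms linear in
    \<open>y - q\<close>, so the basis expansion of \<open>U $ j\<close> applies.\<close>
  also have "\<dots> = (\<Sum>i\<in>tight c. (U $ j \<bullet> w i) * (U $ i \<bullet> (y - q)))"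
  proof (intro sum.cong refl)
    fix i assume "i \<in> tight c"
    then have "form U z i q = 0" using opposite_tight(1)[OF j] q by blast
    then show "(U $ j \<bullet> w i) * ?f i = (U $ j \<bullet> w i) * (U $ i \<bullet> (y - q))"
      using form_diff[of U z i y q] by simp
  qed
  also have "\<dots> = (\<Sum>i\<in>tight c. (U $ j \<bullet> w i) *\<^sub>R U $ i) \<bullet> (y - q)"
    by (simp add: inner_sum_left)
  also have "\<dots> = U $ j \<bullet> (y - q)" unfolding dual_at_expand[OF w, of "U $ j", symmetric] ..
  also have "\<dots> = ?f j"
    using form_diff[of U z j y q] q[of j] j by (simp add: opposite_def)
  finally have "sum ?t (C - {c}) = - ?t c" by (simp add: prod[OF j])
  then show ?thesis unfolding reduce by (simp add: sum.remove[OF finite_C c])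
qed

section \<open>The matrix of \<Delta> and the point \<open>v_pt\<close>\<close>

text \<open>The labels are those at a vertex \<open>c\<close> together with the facet opposite to
  it, \<open>CARD('d) + 1\<close> in all, so the choice in \<open>W_rows\<close> succeeds.\<close>

lemma W_rows_bij: "bij_betw (W_rows F (convex hull C)) UNIV (N \<union> \<tau>)"
proof -
  obtain c where c: "c \<in> C" using ex_other by blast
  obtain j where j: "opposite j c" using ex_opposite_facet[OF c] .
  have "N \<union> \<tau> = insert j (tight c)" using opposite_tight(1)[OF j] j by (auto simp: opposite_def)
  then have "card (N \<union> \<tau>) = CARD('d option)"
    using opposite_tight(2)[OF j] by (simp add: card_tight[OF C_vertex[OF c]])
  then have "\<exists>e :: 'd option \<Rightarrow> 'n. bij_betw e UNIV (N \<union> \<tau>)"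
    using finite_same_card_bij[of "UNIV :: 'd option set" "N \<union> \<tau>"] by auto
  then show ?thesis unfolding W_rows_def by (rule someI_ex)
qed

lemma W_matrix_mult:
  "(W_matrix F U (convex hull C) z *v x) $ r =
     U $ W_rows F (convex hull C) r \<bullet> (\<chi> k. x $ Some k) + z $ W_rows F (convex hull C) r * x $ None"
  by (simp add: matrix_vector_mult_def W_matrix_def UNIV_option_conv sum.reindex inner_vec_def)

text \<open>These are the homogenized equations of the forms; the enumeration of the rows has
  disappeared.\<close>

lemma W_matrix_mult_eq_0_iff:
  "W_matrix F U (convex hull C) z *v x = 0 \<longleftrightarrow>
     (\<forall>i\<in>N \<union> \<tau>. U $ i \<bullet> (\<chi> k. x $ Some k) + z $ i * x $ None = 0)"
proof -
  have "N \<union> \<tau> = range (W_rows F (convex hull C))" using W_rows_bij by (simp add: bij_betw_def)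
  then show ?thesis unfolding vec_eq_iff W_matrix_mult by simp
qed

text \<open>A singular matrix has a nonzero kernel vector. Its entry at \<open>None\<close> is
  nonzero because the rays at \<open>c\<close> separate points, so dividing by it gives a common
  zero. The same separation makes the zero unique, which justifies the definite description.\<close>

lemma W_eq_0_imp_v_pt:
  assumes W: "W F U (convex hull C) z = 0"
  shows "\<forall>i\<in>\<tau> \<union> N. form U z i (v_pt F U (convex hull C) z) = 0"
proof -
  let ?hom = "\<lambda>v :: real ^ 'd. (\<chi> c. case c of Some j \<Rightarrow> v $ j | None \<Rightarrow> 1) :: real ^ 'd option"
  obtain c where c: "c \<in> C" using ex_other by blast
  obtain j where j: "opposite j c" using ex_opposite_facet[OF c] .
  have sub: "tight c \<subseteq> N \<union> \<tau>" using opposite_tight(1)[OF j] by blast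
  have sol: "W_matrix F U (convex hull C) z *v ?hom v = 0 \<longleftrightarrow> (\<forall>i\<in>\<tau> \<union> N. form U z i v = 0)" for v
    unfolding W_matrix_mult_eq_0_iff by (simp add: form_def Un_commute)
  have "\<not> inj ((*v) (W_matrix F U (convex hull C) z))"
    using W det_nz_iff_inj[OF matrix_vector_mul_linear, of "W_matrix F U (convex hull C) z"]
    by (simp add: W_def)
  then obtain x where x: "x \<noteq> 0" "W_matrix F U (convex hull C) z *v x = 0"
    using linear_injective_0[OF matrix_vector_mul_linear[of "W_matrix F U (convex hull C) z"]] by blast
  let ?v = "\<chi> k. x $ Some k"
  have eq: "U $ i \<bullet> ?v + z $ i * x $ None = 0" if "i \<in> N \<union> \<tau>" for i
    using x(2) that unfolding W_matrix_mult_eq_0_iff by blast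
  have "x $ None \<noteq> 0"
  proof
    assume 0: "x $ None = 0"
    have "?v = 0"
      using eq sub 0 by (intro vertex_separates[OF C_vertex[OF c]]) auto
    then have "x $ k = 0" for k using 0 by (cases k) (auto simp: vec_eq_iff)
    then show False using x(1) by (simp add: vec_eq_iff)
  qed
  then have v: "\<forall>i\<in>\<tau> \<union> N. form U z i ((1 / x $ None) *\<^sub>R ?v) = 0"
    using eq by (auto simp: form_def field_simps)
  have "\<exists>!v. W_matrix F U (convex hull C) z *v ?hom v = 0"
  proof (rule ex1I)
    show "W_matrix F U (convex hull C) z *v ?hom ((1 / x $ None) *\<^sub>R ?v) = 0" using v sol by blast
  next
    fix u assume "W_matrix F U (convex hull C) z *v ?hom u = 0"
    then have "\<forall>i\<in>\<tau> \<union> N. form U z i u = 0" using sol by blast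
    then have "u - (1 / x $ None) *\<^sub>R ?v = 0"
      using v sub by (intro vertex_separates[OF C_vertex[OF c]]) (auto simp: form_diff[of U z, symmetric])
    then show "u = (1 / x $ None) *\<^sub>R ?v" by simp
  qed
  then have "W_matrix F U (convex hull C) z *v ?hom (v_pt F U (convex hull C) z) = 0"
    unfolding v_pt_def by (rule theI')
  then show ?thesis using sol by blast
qed

text \<open>The forms at \<open>c\<close> have only one common zero, so \<open>v_pt\<close> is the
  point that the deformation cone attaches to \<open>c\<close>. If it lay inside a segment of
  \<open>deformed U z\<close>, these nonnegative forms would vanish at both ends, and the ends would
  coincide.\<close>

lemma v_pt_extreme_point:
  assumes z: "z \<in> deformation_cone (normal_fan P) U" and W: "W F U (convex hull C) z = 0"
  shows "v_pt F U (convex hull C) z extreme_point_of deformed U z"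
proof -
  let ?v = "v_pt F U (convex hull C) z"
  obtain c where c: "c \<in> C" using ex_other by blast
  obtain j where j: "opposite j c" using ex_opposite_facet[OF c] .
  have v: "form U z i ?v = 0" if "i \<in> tight c" for i
    using W_eq_0_imp_v_pt[OF W] opposite_tight(1)[OF j] that by blast
  have unique: "u = ?v" if "\<forall>i\<in>tight c. form U z i u = 0" for u
  proof -
    have "u - ?v = 0"
      using v that by (intro vertex_separates[OF C_vertex[OF c]]) (auto simp: form_diff[of U z, symmetric])
    then show ?thesis by simp
  qed
  have "?v \<in> deformed U z" using deformation_vertex[OF z C_vertex[OF c]] unique by metis
  moreover have False if ab: "a \<in> deformed U z" "b \<in> deformed U z" "?v \<in> open_segment a b" for a b
  proof -
    obtain t where t: "0 < t" "t < 1" "?v = (1 - t) *\<^sub>R a + t *\<^sub>R b" and "a \<noteq> b"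
      using ab(3) unfolding in_segment by blast
    have "form U z i a = 0 \<and> form U z i b = 0" if i: "i \<in> tight c" for i
    proof -
      have "form U z i ?v = (1 - t) * form U z i a + t * form U z i b"
        unfolding t(3) by (simp add: form_def inner_add_right algebra_simps)
      moreover have "0 \<le> (1 - t) * form U z i a" "0 \<le> t * form U z i b"
        using ab t by (auto simp: deformed_iff)
      ultimately have "(1 - t) * form U z i a = 0" "t * form U z i b = 0" using v[OF i] by linarith+
      then show ?thesis using t by simp
    qed
    then show False using unique[of a] unique[of b] \<open>a \<noteq> b\<close> by simp
  qed
  ultimately show ?thesis by (auto simp: extreme_point_of_def)
qed

end

theorem proposition6p5:
  fixes P \<Delta> :: "(real ^ 'd) set"
    and F :: "'n::finite \<Rightarrow> (real ^ 'd) set"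
    and U :: "real ^ 'd ^ 'n"
    and z\<^sub>0 :: "real ^ 'n"
    and k :: nat
  assumes "simple_polytope P" and "aff_dim P = int CARD('d)"
    and "ray_matrix P F U"
    and "\<Delta> face_of P"
    and "k < CARD('d)" and "(int CARD('d) - int k) simplex \<Delta>"
    and "z\<^sub>0 \<in> deformation_cone (normal_fan P) U"
    and "W F U \<Delta> z\<^sub>0 = 0"
    and "aff_dim (deformed U z\<^sub>0) = int CARD('d)"
    and "card {G. G facet_of deformed U z\<^sub>0} = CARD('n)"
  shows "(\<forall>y. (\<forall>i\<in>cone_rays F \<Delta>. U $ i \<bullet> y + z\<^sub>0 $ i = 0) \<longrightarrow> adj U z\<^sub>0 y = 0) \<and>
    v_pt F U \<Delta> z\<^sub>0 extreme_point_of deformed U z\<^sub>0 \<and> adj U z\<^sub>0 (v_pt F U \<Delta> z\<^sub>0) = 0"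
proof -
  obtain C where C: "\<not> affine_dependent C" "int (card C) = int CARD('d) - int k + 1" "\<Delta> = convex hull C"
    using assms(6) by (auto simp: simplex_def)
  \<comment> \<open>Since \<open>k < CARD('d)\<close>, the cardinality of \<open>C\<close> is at
    least 2.\<close>
  interpret simplex_face P F U C
    using assms C by unfold_locales auto
  have v: "\<forall>i\<in>\<tau> \<union> N. form U z\<^sub>0 i (v_pt F U \<Delta> z\<^sub>0) = 0"
    using W_eq_0_imp_v_pt assms(8) by (simp add: C(3))
  have vanish: "adj U z\<^sub>0 y = 0" if "\<forall>i\<in>cone_rays F \<Delta>. U $ i \<bullet> y + z\<^sub>0 $ i = 0" for y
    unfolding adj_eq[OF assms(7,9,10)]
    using v that by (intro cone_volume_sum_eq_0[of z\<^sub>0 "v_pt F U \<Delta> z\<^sub>0"]) (auto simp: C(3) form_def)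
  moreover have "adj U z\<^sub>0 (v_pt F U \<Delta> z\<^sub>0) = 0"
    using v by (intro vanish) (auto simp: C(3) form_def)
  ultimately show ?thesis
    using v_pt_extreme_point[OF assms(7)] assms(8) by (simp add: C(3))
qed

end
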